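(* Let $p$ be a prime. (i) Let $x=[[b_1,\ldots,b_s,\overline{c_1,\ldots,c_\ell}]]\in\mathbb R_{\rm C}^1$ have an infinite eventually periodic code. Write $$M^{(p)}_{c_1}\cdots M^{(p)}_{c_\ell}=\begin{pmatrix}A&B\\C&D\end{pmatrix}.$$ Then the image $Y=\Phi_p([[\overline{c_1,\ldots,c_\ell}]])$ of the purely periodic tail of $x$ is the unique root in $1+q\mathbb F_p[[q]]$ of the equation $$CY^2+(D-A)Y-B=0.$$ Consequently, $\Phi_p(x)$ is rational (lies in $\mathbb F_p(q)$) if and only if this polynomial splits over $\mathbb F_p(q)$; otherwise $\Phi_p(x)$ has degree exactly $2$ over $\mathbb F_p(q)$. For odd $p$, splitting is equivalent to $(D-A)^2+4BC$ being a square in $\mathbb F_p(q)$. For $p=2$, it is equivalent to $$\frac{BC}{(A+D)^2}\in\{u^2+u:\ u\in\mathbb F_2(q)\}.$$ (ii) Every point $x$ with terminating code $(b_1,\ldots,b_s,\infty)$ has rational image $\Phi_p(x)\in\mathbb F_p(q)$.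
   Context: The Cantor line is $\mathbb R_{\rm C}:=(\mathbb R\setminus\mathbb Q)\sqcup\mathbb Q_+\sqcup\mathbb Q_-\sqcup\{-\infty,+\infty\}$, each rational $r$ being doubled into $r_-<r_+$, ordered in the evident way; $\mathbb R_{\rm C}^1:=[1_+,+\infty]$. Points of $\mathbb R_{\rm C}^1$ correspond bijectively to codes, which are either infinite sequences of integers $\ge2$ or finite sequences of integers $\ge 2$ (possibly empty) followed by the symbol $\infty$: $+\infty$ has code $(\infty)$; $1_+$ has code $(2,2,\ldots)$; if $r=c_1-\frac1{c_2-\cdots\frac1{c_N}}=[[c_1,\ldots,c_N]]>1$ with $c_i\ge2$, then $r_-$ has code $(c_1,\ldots,c_N,\infty)$ and $r_+$ has code $(c_1,\ldots,c_{N-1},c_N+1,2,2,\ldots)$; an irrational $x>1$ has as code the digits $c_j\ge 2$ of its infinite expansion $x=c_1-\frac{1}{c_2-\frac{1}{c_3-\cdots}}$. $[[\ldots]]$ denotes the point with the given code, and an overline denotes infinite periodic repetition. $[n]_q=\frac{1-q^n}{1-q}$. On $\mathbb R_{\rm C}^1$ the map $\Phi_p:\mathbb R_{\rm C}^1\to1+q\mathbb F_p[[q]]$ sends $+\infty$ to $(1-q)^{-1}$, and sends the point with infinite code $(c_1,c_2,\ldots)$ to the reduction mod $p$ of the $q$-adic limit of $[c_1]_q-\frac{q^{c_1-1}}{[c_2]_q-\cdots\frac{q^{c_{N-1}-1}}{[c_N]_q}}$, and the point with code $(c_1,\ldots,c_N,\infty)$ to the reduction mod $p$ of the same finite expression with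 the last entry $[c_N]_q$ replaced by $[c_N]_q-q^{c_N-1}(1-q)$. For an integer $a\ge2$, $M_a^{(p)}=M_a^{(p)}(q):=\begin{pmatrix}[a]_q&-q^{a-1}\\1&0\end{pmatrix}\in\mathrm{Mat}_2(\mathbb F_p[q])$. *)

theory Defs
  imports
    "HOL-Analysis.Analysis"
    "HOL-Library.Stream"
    "HOL-Computational_Algebra.Formal_Laurent_Series"
    "HOL-Computational_Algebra.Polynomial_FPS"
    "Berlekamp_Zassenhaus.Finite_Field"
begin

text \<open>
  Throughout, the prime \<open>p\<close> is the cardinality of a type \<open>'p :: prime_card\<close>, and
  the field with \<open>p\<close> elements is \<open>'p mod_ring\<close>.
\<close>

section \<open>The Cantor line\<close>

text \<open>
  A point is an extended real together with a sign: \<open>-1\<close> or \<open>1\<close> for the two copies of a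
  rational, and \<open>0\<close> for irrational and infinite points.
\<close>

typedef cantor_line =
  "{(x :: ereal, s :: int). if x \<in> ereal ` \<rat> then s = -1 \<or> s = 1 else s = 0}"
  by (rule exI[of _ "(\<infinity>, 0)"]) auto

instantiation cantor_line :: linorder
begin

definition less_eq_cantor_line :: "cantor_line \<Rightarrow> cantor_line \<Rightarrow> bool" where
  "x \<le> y \<longleftrightarrow> (let (a, s) = Rep_cantor_line x; (b, t) = Rep_cantor_line y in
     a < b \<or> a = b \<and> s \<le> t)"

definition less_cantor_line :: "cantor_line \<Rightarrow> cantor_line \<Rightarrow> bool" where
  "x < y \<longleftrightarrow> (let (a, s) = Rep_cantor_line x; (b, t) = Rep_cantor_line y in
     a < b \<or> a = b \<and> s < t)"

instance
  by standard
    (auto simp: less_eq_cantor_line_def less_cantor_line_def Let_def prod_eq_iff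
      simp flip: Rep_cantor_line_inject split: prod.splits)

end

definition rat_minus :: "real \<Rightarrow> cantor_line" where
  "rat_minus r = Abs_cantor_line (ereal r, -1)"

definition rat_plus :: "real \<Rightarrow> cantor_line" where
  "rat_plus r = Abs_cantor_line (ereal r, 1)"

definition irrat :: "real \<Rightarrow> cantor_line" where
  "irrat x = Abs_cantor_line (ereal x, 0)"

definition plus_inf :: cantor_line where
  "plus_inf = Abs_cantor_line (\<infinity>, 0)"

definition cantor_line1 :: "cantor_line set" where
  "cantor_line1 = {rat_plus 1..plus_inf}"


section \<open>Codes\<close>

text \<open>
  \<open>Terminating cs\<close> is the code consisting of the digits \<open>cs\<close> followed by the symbol
  \<open>\<infinity>\<close>.
\<close>

datatype code = Infinite "nat stream" | Terminating "nat list"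

fun neg_cfrac :: "nat list \<Rightarrow> real" where
  "neg_cfrac [] = 0"
| "neg_cfrac [c] = real c"
| "neg_cfrac (c # d # ds) = real c - 1 / neg_cfrac (d # ds)"

inductive has_code :: "cantor_line \<Rightarrow> code \<Rightarrow> bool" where
  "has_code plus_inf (Terminating [])"
| "has_code (rat_plus 1) (Infinite (sconst 2))"
| "cs \<noteq> [] \<Longrightarrow> \<forall>c\<in>set cs. 2 \<le> c \<Longrightarrow>
     has_code (rat_minus (neg_cfrac cs)) (Terminating cs)"
| "cs \<noteq> [] \<Longrightarrow> \<forall>c\<in>set cs. 2 \<le> c \<Longrightarrow>
     has_code (rat_plus (neg_cfrac cs)) (Infinite ((butlast cs @ [last cs + 1]) @- sconst 2))"
| "x \<notin> \<rat> \<Longrightarrow> 1 < x \<Longrightarrow> \<forall>c\<in>sset s. 2 \<le> c \<Longrightarrow>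
     (\<lambda>n. neg_cfrac (stake (Suc n) s)) \<longlonglongrightarrow> x \<Longrightarrow>
     has_code (irrat x) (Infinite s)"

definition code_of :: "cantor_line \<Rightarrow> code" where
  "code_of x = (THE c. has_code x c)"

definition point_of_code :: "code \<Rightarrow> cantor_line" where
  "point_of_code c = (THE x. x \<in> cantor_line1 \<and> has_code x c)"


section \<open>The map \<open>\<Phi>\<close>\<close>

definition q_number :: "'a :: comm_ring_1 \<Rightarrow> nat \<Rightarrow> 'a" where
  "q_number q n = (\<Sum>i<n. q ^ i)"

lemma q_number_eq: "(1 - q) * q_number q n = 1 - q ^ n"
  unfolding q_number_def by (rule one_diff_power_eq[symmetric])

text \<open>
  \<open>q_cfrac [c\<^sub>1, \<dots>, c\<^sub>m] e\<close> is the finite fraction with entries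
  \<open>[c\<^sub>1]\<^sub>q, \<dots>, [c\<^sub>m]\<^sub>q, e\<close>. Division is multiplication by \<open>fps_right_inverse f 1\<close>,
  the inverse of \<open>f\<close> over the integers; all denominators have constant coefficient 1
  as soon as \<open>e\<close> does and \<open>c\<^sub>j \<ge> 2\<close> for all \<open>j\<close>.
\<close>

fun q_cfrac :: "nat list \<Rightarrow> int fps \<Rightarrow> int fps" where
  "q_cfrac [] e = e"
| "q_cfrac (c # cs) e =
     q_number fps_X c - fps_X ^ (c - 1) * fps_right_inverse (q_cfrac cs e) 1"

definition reduce_fps :: "int fps \<Rightarrow> 'p :: prime_card mod_ring fps" where
  "reduce_fps f = Abs_fps (\<lambda>n. of_int (fps_nth f n))"

fun Phi_code :: "code \<Rightarrow> 'p :: prime_card mod_ring fps" where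
  "Phi_code (Infinite s) =
     reduce_fps (lim (\<lambda>n. q_cfrac (stake n s) (q_number fps_X (s !! n))))"
| "Phi_code (Terminating cs) =
     (if cs = [] then inverse (1 - fps_X)
      else reduce_fps (q_cfrac (butlast cs)
        (q_number fps_X (last cs) - fps_X ^ (last cs - 1) * (1 - fps_X))))"

definition Phi :: "cantor_line \<Rightarrow> 'p :: prime_card mod_ring fps" where
  "Phi x = Phi_code (code_of x)"


section \<open>Matrices\<close>

definition mat22 :: "'a :: zero \<Rightarrow> 'a \<Rightarrow> 'a \<Rightarrow> 'a \<Rightarrow> 'a ^ 2 ^ 2" where
  "mat22 a b c d = vector [vector [a, b], vector [c, d]]"

definition M_mat :: "nat \<Rightarrow> 'p :: prime_card mod_ring poly ^ 2 ^ 2" where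
  "M_mat a = mat22 (q_number [:0, 1:] a) (- ([:0, 1:] ^ (a - 1))) 1 0"

definition M_prod :: "nat list \<Rightarrow> 'p :: prime_card mod_ring poly ^ 2 ^ 2" where
  "M_prod cs = foldr (\<lambda>a N. M_mat a ** N) cs (mat 1)"


section \<open>Rational functions, splitting and degree\<close>

abbreviation fls_of_poly :: "'a :: field poly \<Rightarrow> 'a fls" where
  "fls_of_poly f \<equiv> fps_to_fls (fps_of_poly f)"

text \<open>The field of rational functions, as a subfield of the field of Laurent series.\<close>

definition rat_funs :: "'a :: field fls set" where
  "rat_funs = {fls_of_poly f / fls_of_poly g | f g. g \<noteq> 0}"

definition splits_over :: "'a :: field set \<Rightarrow> 'a poly \<Rightarrow> bool" where
  "splits_over K f \<longleftrightarrow>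
     (\<exists>a rs. a \<in> K \<and> set rs \<subseteq> K \<and> f = Polynomial.smult a (\<Prod>r\<leftarrow>rs. [:- r, 1:]))"

definition is_min_poly :: "'a :: field set \<Rightarrow> 'a \<Rightarrow> 'a poly \<Rightarrow> bool" where
  "is_min_poly K y f \<longleftrightarrow>
     Polynomial.lead_coeff f = 1 \<and> set (Polynomial.coeffs f) \<subseteq> K \<and> poly f y = 0 \<and>
     (\<forall>g. g \<noteq> 0 \<and> set (Polynomial.coeffs g) \<subseteq> K \<and> poly g y = 0 \<longrightarrow> Polynomial.degree f \<le> Polynomial.degree g)"

text \<open>\<open>y\<close> is algebraic of degree exactly \<open>n\<close> over the subfield \<open>K\<close>.\<close>

definition has_degree_over :: "'a :: field set \<Rightarrow> 'a \<Rightarrow> nat \<Rightarrow> bool" where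
  "has_degree_over K y n \<longleftrightarrow> (\<exists>f. is_min_poly K y f \<and> Polynomial.degree f = n)"

end

theory Submission
  imports Defs
begin

text \<open>
  The map \<open>\<Phi>\<close> is defined on points through their codes, so the first task is to see that
  codes and points determine each other. A terminating code gives \<open>+\<infinity>\<close> or the lower copy of
  a rational number, and the value of a finite negative continued fraction determines its
  digits. For an infinite code the truncated fractions decrease to a value \<open>v \<ge> 1\<close>, digits are
  recovered from \<open>v\<close> by taking floors, and \<open>v\<close> is rational exactly if the digits are eventually
  \<open>2\<close>. So the code belongs to the irrational point \<open>v\<close> or to the upper copy of the rational
  number \<open>v\<close> (\<open>has_code_Infinite_iff\<close>), and \<open>\<Phi>\<close> of the point with a given code can be computed
  from this code (\<open>code_of_point_of_code\<close>).

  The truncations of the \<open>q\<close>-deformed fraction converge \<open>q\<close>-adically, and their limits satisfy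
  \<open>Y (c s) Y s = [c] Y s - q ^ (c - 1)\<close>, where \<open>c s\<close> is the code \<open>s\<close> with the digit \<open>c\<close> prepended.
  In other words, prepending digits acts on \<open>Y\<close> by the linear fractional transformation with
  matrix \<open>M_prod\<close> (\<open>Phi_code_shift\<close>). The purely periodic tail is a fixed point of the
  transformation of its period, which is the quadratic equation of the theorem. At \<open>q = 0\<close> the
  matrix of the period has rows \<open>(1, 0)\<close> and \<open>(1, 0)\<close>; hence the equation has only one solution
  with constant coefficient \<open>1\<close> (\<open>cycle_equation_unique\<close>), its leading coefficient \<open>C\<close> does not
  vanish, and neither does \<open>A + D\<close>.

  The rest is algebra over the subfield \<open>K\<close> of rational functions of the field of Laurent
  series. A quadratic polynomial over \<open>K\<close> with root \<open>y\<close> splits if and only if \<open>y \<in> K\<close>, which is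
  decided by the discriminant or, in characteristic two, by an Artin--Schreier equation. The
  preperiod acts by a linear fractional transformation over \<open>K\<close> with non-zero determinant, and
  such a transformation preserves both membership in \<open>K\<close> and having degree two over \<open>K\<close>.
  Finally, the image of a terminating code is a finite continued fraction with entries in \<open>K\<close>.
\<close>

(* From here on, $ selects entries of vectors and matrices only; coefficients of power series
   are written with fps_nth. *)
no_notation fps_nth (infixl "$" 75)

section \<open>Negative continued fractions of real numbers\<close>

text \<open>
  The convention \<open>1 / 0 = 0\<close> makes the recursion uniform: it also covers the last digit.
\<close>

lemma neg_cfrac_Cons: "neg_cfrac (c # cs) = real c - 1 / neg_cfrac cs"
  by (cases cs) auto

lemma neg_cfrac_gt_1:
  assumes "cs \<noteq> []" "\<forall>c\<in>set cs. 2 \<le> c"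
  shows "1 < neg_cfrac cs"
  using assms
proof (induction cs)
  case (Cons c cs)
  show ?case
  proof (cases "cs = []")
    case False
    then have "1 < neg_cfrac cs" using Cons by simp
    then have "1 / neg_cfrac cs < 1" by simp
    moreover have "2 \<le> real c" using Cons.prems by simp
    ultimately show ?thesis by (simp add: neg_cfrac_Cons)
  qed (use Cons.prems in simp)
qed simp

lemma neg_cfrac_Cons_bounds:
  assumes "\<forall>c\<in>set cs. 2 \<le> c"
  shows "real c - 1 < neg_cfrac (c # cs)" "neg_cfrac (c # cs) \<le> real c"
proof -
  have "0 \<le> 1 / neg_cfrac cs \<and> 1 / neg_cfrac cs < 1"
    using neg_cfrac_gt_1[OF _ assms] by (cases "cs = []") auto
  then show "real c - 1 < neg_cfrac (c # cs)" "neg_cfrac (c # cs) \<le> real c"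
    by (simp_all add: neg_cfrac_Cons)
qed

text \<open>
  The first digit is recovered as the ceiling of the value, and then the value of the tail.
\<close>

lemma neg_cfrac_inj:
  assumes "\<forall>c\<in>set cs. 2 \<le> c" "\<forall>d\<in>set ds. 2 \<le> d" "neg_cfrac cs = neg_cfrac ds"
  shows "cs = ds"
  using assms
proof (induction cs arbitrary: ds)
  case Nil
  then show ?case using neg_cfrac_gt_1[of ds] by (cases "ds = []") auto
next
  case (Cons c cs)
  from Cons.prems neg_cfrac_gt_1[of "c # cs"] obtain d ds' where ds: "ds = d # ds'"
    by (cases ds) auto
  have "real c - 1 < real d" "real d - 1 < real c"
    using neg_cfrac_Cons_bounds[of cs c] neg_cfrac_Cons_bounds[of ds' d] Cons.prems
    by (auto simp: ds)
  then have "c = d" by linarith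
  then have "neg_cfrac cs = neg_cfrac ds'"
    using Cons.prems(3) by (simp add: ds neg_cfrac_Cons)
  then have "cs = ds'" using Cons.IH[of ds'] Cons.prems(1,2) by (simp add: ds)
  then show ?case using ds \<open>c = d\<close> by simp
qed

lemma neg_cfrac_rational: "neg_cfrac cs \<in> \<rat>"
  by (induction cs) (auto simp: neg_cfrac_Cons)

definition cfrac_value :: "nat stream \<Rightarrow> real" where
  "cfrac_value s = lim (\<lambda>n. neg_cfrac (stake (Suc n) s))"

lemma set_stake_subset: "set (stake n s) \<subseteq> sset s"
  using sset_shift[of "stake n s" "sdrop n s"] by (simp add: stake_sdrop)

lemma sset_stl_subset: "sset (stl s) \<subseteq> sset s"
  by (cases s) auto

lemma neg_cfrac_stake_gt_1:
  assumes "\<forall>c\<in>sset s. 2 \<le> c"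
  shows "1 < neg_cfrac (stake (Suc n) s)"
  using assms set_stake_subset[of "Suc n" s]
  by (intro neg_cfrac_gt_1) (simp, blast)

lemma neg_cfrac_stake_decreasing:
  assumes "\<forall>c\<in>sset s. 2 \<le> c"
  shows "neg_cfrac (stake (Suc (Suc n)) s) \<le> neg_cfrac (stake (Suc n) s)"
  using assms
proof (induction n arbitrary: s)
  case 0
  show ?case by simp
next
  case (Suc n)
  have t: "\<forall>c\<in>sset (stl s). 2 \<le> c" using Suc.prems sset_stl_subset[of s] by auto
  have "1 / neg_cfrac (stake (Suc n) (stl s)) \<le> 1 / neg_cfrac (stake (Suc (Suc n)) (stl s))"
    using Suc.IH[OF t] neg_cfrac_stake_gt_1[OF t, of n] neg_cfrac_stake_gt_1[OF t, of "Suc n"]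
    by (intro divide_left_mono mult_pos_pos) (simp_all del: stake.simps)
  then show ?case
    unfolding stake.simps(2)[of "Suc n"] stake.simps(2)[of "Suc (Suc n)"] neg_cfrac_Cons
    by (simp del: stake.simps)
qed

text \<open>
  The truncations of an infinite expansion decrease and stay above \<open>1\<close>, so they converge.
\<close>

lemma cfrac_value_limit:
  assumes "\<forall>c\<in>sset s. 2 \<le> c"
  shows "(\<lambda>n. neg_cfrac (stake (Suc n) s)) \<longlonglongrightarrow> cfrac_value s"
proof -
  have "decseq (\<lambda>n. neg_cfrac (stake (Suc n) s))"
    using neg_cfrac_stake_decreasing[OF assms] by (rule decseq_SucI)
  moreover have "\<And>n. 1 \<le> neg_cfrac (stake (Suc n) s)"
    using neg_cfrac_stake_gt_1[OF assms] less_imp_le by blast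
  ultimately have "convergent (\<lambda>n. neg_cfrac (stake (Suc n) s))"
    using decseq_convergent unfolding convergent_def by metis
  then show ?thesis
    unfolding cfrac_value_def using convergent_LIMSEQ_iff by blast
qed

lemma cfrac_value_ge_1:
  assumes "\<forall>c\<in>sset s. 2 \<le> c"
  shows "1 \<le> cfrac_value s"
  using cfrac_value_limit[OF assms] neg_cfrac_stake_gt_1[OF assms]
  by (intro LIMSEQ_le_const) (auto intro: less_imp_le)

lemma cfrac_value_SCons:
  assumes "2 \<le> c" "\<forall>d\<in>sset s. 2 \<le> d"
  shows "cfrac_value (c ## s) = real c - 1 / cfrac_value s"
proof -
  have "(\<lambda>n. real c - 1 / neg_cfrac (stake (Suc n) s)) \<longlonglongrightarrow> real c - 1 / cfrac_value s"
    using cfrac_value_ge_1[OF assms(2)]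
    by (intro tendsto_intros cfrac_value_limit assms) auto
  then have "(\<lambda>n. neg_cfrac (stake (Suc (Suc n)) (c ## s))) \<longlonglongrightarrow> real c - 1 / cfrac_value s"
    by (simp add: neg_cfrac_Cons)
  moreover have "(\<lambda>n. neg_cfrac (stake (Suc (Suc n)) (c ## s))) \<longlonglongrightarrow> cfrac_value (c ## s)"
    using cfrac_value_limit[of "c ## s"] assms by (subst filterlim_sequentially_Suc) auto
  ultimately show ?thesis using LIMSEQ_unique by blast
qed

lemma sconst_unfold: "sconst c = c ## sconst c"
  by (rule trans[OF siterate.code]) simp

lemma cfrac_value_sconst_2: "cfrac_value (sconst 2) = 1"
proof -
  let ?v = "cfrac_value (sconst 2)"
  have "?v = cfrac_value (2 ## sconst 2)"
    using sconst_unfold by (rule arg_cong)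
  also have "\<dots> = 2 - 1 / ?v"
    using cfrac_value_SCons[of 2 "sconst 2"] by simp
  finally have "?v = 2 - 1 / ?v" .
  moreover have "1 \<le> ?v" by (rule cfrac_value_ge_1) simp
  ultimately have "(?v - 1)\<^sup>2 = 0" by (simp add: field_simps power2_eq_square)
  then show ?thesis by simp
qed

lemma cfrac_value_eq_1_imp_sconst_2:
  assumes "\<forall>c\<in>sset s. 2 \<le> c" "cfrac_value s = 1"
  shows "s = sconst 2"
proof -
  have "s !! n = 2" for n
    using assms
  proof (induction n arbitrary: s)
    case (0 s)
    obtain c t where s: "s = c ## t" by (cases s)
    have "1 \<le> cfrac_value t" using 0 by (intro cfrac_value_ge_1) (auto simp: s)
    then have "1 / cfrac_value t \<le> 1" by simp
    then show ?case using 0 cfrac_value_SCons[of c t] by (auto simp: s)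
  next
    case (Suc n s)
    obtain c t where s: "s = c ## t" by (cases s)
    have t: "1 \<le> cfrac_value t" using Suc.prems by (intro cfrac_value_ge_1) (auto simp: s)
    then have "1 / cfrac_value t \<le> 1" by simp
    moreover have "1 = real c - 1 / cfrac_value t"
      using Suc.prems cfrac_value_SCons[of c t] by (auto simp: s)
    moreover have "2 \<le> real c" using Suc.prems by (auto simp: s)
    ultimately have "1 / cfrac_value t = 1" by linarith
    then have "cfrac_value t = 1" using t by (simp add: field_simps)
    then show ?case using Suc by (simp add: s)
  qed
  then have "sset s = {2}" by (auto simp: sset_range)
  then show ?thesis by (simp add: sconst_alt)
qed

text \<open>
  The first digit is one more than the floor of the value, because the tail has value at
  least \<open>1\<close>; so all digits can be read off one after the other.
\<close>

lemma cfrac_value_inj: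
  assumes "\<forall>c\<in>sset s. 2 \<le> c" "\<forall>c\<in>sset t. 2 \<le> c" "cfrac_value s = cfrac_value t"
  shows "s = t"
  using assms
proof (coinduction arbitrary: s t)
  case (Eq_stream s t)
  obtain c s' where s: "s = c ## s'" by (cases s)
  obtain d t' where t: "t = d ## t'" by (cases t)
  have v: "1 \<le> cfrac_value s'" "1 \<le> cfrac_value t'"
    using Eq_stream by (auto intro: cfrac_value_ge_1 simp: s t)
  have eq: "real c - 1 / cfrac_value s' = real d - 1 / cfrac_value t'"
    using Eq_stream cfrac_value_SCons[of c s'] cfrac_value_SCons[of d t'] by (simp add: s t)
  have "0 < 1 / cfrac_value s'" "1 / cfrac_value s' \<le> 1"
    "0 < 1 / cfrac_value t'" "1 / cfrac_value t' \<le> 1"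
    using v by auto
  then have "c = d" using eq by linarith
  moreover from this eq have "cfrac_value s' = cfrac_value t'" by simp
  ultimately show ?case using Eq_stream by (simp add: s t)
qed

text \<open>
  A rational value forces the digits to be eventually \<open>2\<close>: the tails of an expansion of
  \<open>a / b\<close> are again rational, and their denominators strictly decrease until the value
  \<open>1\<close> is reached.
\<close>

lemma cfrac_value_rational_imp_tail_2:
  assumes "\<forall>c\<in>sset s. 2 \<le> c" "cfrac_value s = of_int a / real b" "0 < b"
  shows "\<exists>n. sdrop n s = sconst 2"
  using assms
proof (induction b arbitrary: s a rule: less_induct)
  case (less b)
  obtain c t where s: "s = c ## t" by (cases s)
  have t: "\<forall>c\<in>sset t. 2 \<le> c" and c: "2 \<le> c" using less.prems by (auto simp: s)
  show ?case
  proof (cases "cfrac_value t = 1")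
    case True
    then have "sdrop 1 s = sconst 2"
      using cfrac_value_eq_1_imp_sconst_2[OF t] by (simp add: s)
    then show ?thesis by blast
  next
    case False
    then have v: "1 < cfrac_value t" using cfrac_value_ge_1[OF t] by simp
    have eq: "real c - of_int a / real b = 1 / cfrac_value t"
      using less.prems cfrac_value_SCons[OF c t] by (simp add: s)
    define b' where "b' = int c * int b - a"
    have b': "real_of_int b' = real b / cfrac_value t"
      using eq less.prems(3) by (simp add: b'_def field_simps)
    then have "0 < real_of_int b'" using v less.prems(3) by simp
    then have b'_pos: "0 < b'" by simp
    have "real_of_int b' < real b" using v less.prems(3) by (simp add: b' field_simps)
    then have "nat b' < b" using b'_pos by linarith
    moreover have "cfrac_value t = of_int (int b) / real (nat b')"
      using b' b'_pos v by (simp add: field_simps)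
    moreover have "0 < nat b'" using b'_pos by simp
    ultimately obtain n where "sdrop n t = sconst 2"
      using less.IH[of "nat b'" t "int b"] t by blast
    then have "sdrop (Suc n) s = sconst 2" by (simp add: s)
    then show ?thesis by blast
  qed
qed

lemma right_code_digits:
  assumes "cs \<noteq> []" "\<forall>c\<in>set cs. 2 \<le> c" "\<forall>c\<in>sset z. 2 \<le> c"
  shows "\<forall>c\<in>sset ((butlast cs @ [last cs + 1]) @- z). (2::nat) \<le> c"
  using assms by (cases cs rule: rev_cases) auto

text \<open>
  The tail \<open>z\<close> plays the role of \<open>2, 2, \<dots>\<close>: its value is \<open>1\<close>, and \<open>(c + 1) - 1 / 1 = c\<close>.
\<close>

lemma cfrac_value_right_code:
  assumes "cs \<noteq> []" "\<forall>c\<in>set cs. 2 \<le> c"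
    and z: "\<forall>c\<in>sset z. 2 \<le> c" "cfrac_value z = 1"
  shows "cfrac_value ((butlast cs @ [last cs + 1]) @- z) = neg_cfrac cs"
  using assms(1,2)
proof (induction cs)
  case (Cons c cs)
  show ?case
  proof (cases "cs = []")
    case True
    then show ?thesis using Cons.prems z cfrac_value_SCons[of "Suc c" z] by simp
  next
    case False
    have "\<forall>d\<in>sset ((butlast cs @ [last cs + 1]) @- z). 2 \<le> d"
      using Cons.prems False z by (intro right_code_digits) auto
    then show ?thesis
      using Cons False cfrac_value_SCons[of c "(butlast cs @ [last cs + 1]) @- z"]
      by (simp add: neg_cfrac_Cons)
  qed
qed simp

text \<open>
  A code that is eventually \<open>2\<close> is of one of the two forms that are assigned to upper copies of
  rational numbers: either all digits are \<open>2\<close>, or the last other digit is some \<open>c + 1 \<ge> 3\<close>.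
\<close>

lemma tail_2_cases:
  assumes z: "z = (2::nat) ## z" and "sdrop n s = z" "\<forall>c\<in>sset s. 2 \<le> c"
  shows "s = z \<or>
    (\<exists>cs. cs \<noteq> [] \<and> (\<forall>c\<in>set cs. 2 \<le> c) \<and> s = (butlast cs @ [last cs + 1]) @- z)"
  using assms(2,3)
proof (induction n arbitrary: s)
  case (Suc n)
  obtain c t where s: "s = c ## t" by (cases s)
  have t: "\<forall>d\<in>sset t. 2 \<le> d" and c: "2 \<le> c" using Suc.prems by (auto simp: s)
  have "sdrop n t = z" using Suc.prems by (simp add: s)
  then have IH: "t = z \<or>
      (\<exists>cs. cs \<noteq> [] \<and> (\<forall>c\<in>set cs. 2 \<le> c) \<and> t = (butlast cs @ [last cs + 1]) @- z)"
    using t by (rule Suc.IH)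
  have "c = 2 \<or> 3 \<le> c" using c by linarith
  with IH consider "t = z" "c = 2" | "t = z" "3 \<le> c"
    | cs where "cs \<noteq> []" "\<forall>d\<in>set cs. 2 \<le> d" "t = (butlast cs @ [last cs + 1]) @- z"
    by blast
  then show ?case
  proof cases
    case 1
    then show ?thesis using s z by simp
  next
    case 2
    then show ?thesis by (intro disjI2 exI[of _ "[c - 1]"]) (auto simp: s)
  next
    case 3
    then show ?thesis using c by (intro disjI2 exI[of _ "c # cs"]) (auto simp: s)
  qed
qed simp


section \<open>Points and codes correspond bijectively\<close>

lemma Rep_rat_minus: "r \<in> \<rat> \<Longrightarrow> Rep_cantor_line (rat_minus r) = (ereal r, -1)"
  unfolding rat_minus_def by (subst Abs_cantor_line_inverse) auto

lemma Rep_rat_plus: "r \<in> \<rat> \<Longrightarrow> Rep_cantor_line (rat_plus r) = (ereal r, 1)"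
  unfolding rat_plus_def by (subst Abs_cantor_line_inverse) auto

lemma Rep_irrat: "x \<notin> \<rat> \<Longrightarrow> Rep_cantor_line (irrat x) = (ereal x, 0)"
  unfolding irrat_def by (subst Abs_cantor_line_inverse) auto

lemma Rep_plus_inf: "Rep_cantor_line plus_inf = (\<infinity>, 0)"
  unfolding plus_inf_def by (subst Abs_cantor_line_inverse) auto

lemmas Rep_points = Rep_rat_minus Rep_rat_plus Rep_irrat Rep_plus_inf

lemma has_code_Terminating_iff:
  "has_code x (Terminating cs) \<longleftrightarrow>
     (\<forall>c\<in>set cs. 2 \<le> c) \<and> x = (if cs = [] then plus_inf else rat_minus (neg_cfrac cs))"
  by (auto intro: has_code.intros elim: has_code.cases)

text \<open>
  Infinite codes are limits from above, so a rational value stands for the upper copy.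
\<close>

definition right_point :: "real \<Rightarrow> cantor_line" where
  "right_point v = (if v \<in> \<rat> then rat_plus v else irrat v)"

lemma has_code_Infinite_iff:
  "has_code x (Infinite s) \<longleftrightarrow> (\<forall>c\<in>sset s. 2 \<le> c) \<and> x = right_point (cfrac_value s)"
proof
  assume "has_code x (Infinite s)"
  then show "(\<forall>c\<in>sset s. 2 \<le> c) \<and> x = right_point (cfrac_value s)"
  proof cases
    case 2
    then show ?thesis by (simp add: right_point_def cfrac_value_sconst_2)
  next
    case (4 cs)
    have "\<forall>c\<in>sset s. 2 \<le> c"
      unfolding 4 using 4 by (intro right_code_digits) auto
    then show ?thesis
      using 4 cfrac_value_right_code[of cs "sconst 2"] neg_cfrac_rational[of cs]
      by (simp only: right_point_def cfrac_value_sconst_2 sset_sconst) simp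
  next
    case (5 v)
    then have "cfrac_value s = v" using LIMSEQ_unique cfrac_value_limit by blast
    then show ?thesis using 5 by (auto simp: right_point_def)
  qed
next
  assume *: "(\<forall>c\<in>sset s. 2 \<le> c) \<and> x = right_point (cfrac_value s)"
  show "has_code x (Infinite s)"
  proof (cases "cfrac_value s \<in> \<rat>")
    case True
    then obtain a b where "cfrac_value s = of_int a / real b" "0 < b"
      by (metis Rats_cases' of_int_of_nat_eq zero_less_imp_eq_int)
    then obtain n where "sdrop n s = sconst 2"
      using * cfrac_value_rational_imp_tail_2 by blast
    then consider "s = sconst 2"
      | cs where "cs \<noteq> []" "\<forall>c\<in>set cs. 2 \<le> c" "s = (butlast cs @ [last cs + 1]) @- sconst 2"
      using * tail_2_cases[OF sconst_unfold, of n s] by blast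
    then show ?thesis
    proof cases
      case 1
      then show ?thesis using * has_code.intros(2)
        by (simp add: right_point_def cfrac_value_sconst_2)
    next
      case 2
      then show ?thesis using * has_code.intros(4)[of cs] neg_cfrac_rational[of cs]
          cfrac_value_right_code[of cs "sconst 2"]
        by (simp only: right_point_def cfrac_value_sconst_2 sset_sconst) simp
    qed
  next
    case False
    then have "cfrac_value s \<noteq> 1" by auto
    then have "1 < cfrac_value s" using * cfrac_value_ge_1[of s] by auto
    then show ?thesis
      using * False has_code.intros(5)[of "cfrac_value s" s] cfrac_value_limit[of s]
      by (simp add: right_point_def)
  qed
qed

lemma has_code_unique_point: "has_code x c \<Longrightarrow> has_code y c \<Longrightarrow> x = y"
  by (cases c) (auto simp: has_code_Infinite_iff has_code_Terminating_iff)

lemma Rep_right_point: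
  "Rep_cantor_line (right_point v) = (ereal v, if v \<in> \<rat> then 1 else 0)"
  by (simp add: right_point_def Rep_points)

text \<open>
  Infinite and terminating codes never share a point: only the latter give \<open>+\<infinity>\<close> and the
  lower copies of rational numbers.
\<close>

lemma has_code_unique_code:
  assumes "has_code x c" "has_code x d"
  shows "c = d"
proof -
  have rep: "Rep_cantor_line (if cs = [] then plus_inf else rat_minus (neg_cfrac cs)) =
      (if cs = [] then (\<infinity>, 0) else (ereal (neg_cfrac cs), -1))" for cs
    using neg_cfrac_rational by (simp add: Rep_points)
  show ?thesis
  proof (cases c; cases d)
    fix s t assume cd: "c = Infinite s" "d = Infinite t"
    then have "right_point (cfrac_value s) = right_point (cfrac_value t)"
      using assms by (simp add: has_code_Infinite_iff)
    then have "Rep_cantor_line (right_point (cfrac_value s)) =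
        Rep_cantor_line (right_point (cfrac_value t))"
      by (rule arg_cong)
    then have "cfrac_value s = cfrac_value t"
      by (simp only: Rep_right_point prod.inject ereal.inject)
    then show "c = d" using assms cd cfrac_value_inj by (auto simp: has_code_Infinite_iff)
  next
    fix s cs assume "c = Infinite s" "d = Terminating cs"
    then have "Rep_cantor_line (right_point (cfrac_value s)) =
        (if cs = [] then (\<infinity>, 0) else (ereal (neg_cfrac cs), -1))"
      using assms rep[of cs] by (simp add: has_code_Infinite_iff has_code_Terminating_iff)
    then show "c = d" by (auto simp: Rep_right_point split: if_splits)
  next
    fix s cs assume "c = Terminating cs" "d = Infinite s"
    then have "Rep_cantor_line (right_point (cfrac_value s)) =
        (if cs = [] then (\<infinity>, 0) else (ereal (neg_cfrac cs), -1))"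
      using assms rep[of cs] by (simp add: has_code_Infinite_iff has_code_Terminating_iff)
    then show "c = d" by (auto simp: Rep_right_point split: if_splits)
  next
    fix cs ds assume cd: "c = Terminating cs" "d = Terminating ds"
    then have "(if cs = [] then (\<infinity>, 0::int) else (ereal (neg_cfrac cs), -1)) =
        (if ds = [] then (\<infinity>, 0) else (ereal (neg_cfrac ds), -1))"
      using assms rep[of cs] rep[of ds] by (simp only: has_code_Terminating_iff)
    then have "cs = [] \<and> ds = [] \<or> neg_cfrac cs = neg_cfrac ds" by (simp split: if_splits)
    then show "c = d"
      using assms cd neg_cfrac_inj by (auto simp: has_code_Terminating_iff)
  qed
qed

lemma has_code_in_cantor_line1:
  assumes "has_code x c"
  shows "x \<in> cantor_line1"
proof (cases c)
  case (Infinite s)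
  then have "1 \<le> cfrac_value s"
    using assms cfrac_value_ge_1 by (simp add: has_code_Infinite_iff)
  moreover from this have "1 < cfrac_value s" if "cfrac_value s \<notin> \<rat>"
    using that by (cases "cfrac_value s = 1") auto
  ultimately show ?thesis
    using assms Infinite
    by (auto simp: has_code_Infinite_iff cantor_line1_def less_eq_cantor_line_def Rep_points
        Rep_right_point one_ereal_def)
next
  case (Terminating cs)
  then show ?thesis
    using assms neg_cfrac_gt_1[of cs] neg_cfrac_rational[of cs]
    by (auto simp: has_code_Terminating_iff cantor_line1_def less_eq_cantor_line_def Rep_points
        one_ereal_def)
qed

text \<open>
  Existence and uniqueness in both directions turn the two definite descriptions into mutually
  inverse maps.
\<close>

lemma code_of_point_of_code:
  assumes "has_code x c"
  shows "code_of (point_of_code c) = c"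
proof -
  have "point_of_code c = x"
    unfolding point_of_code_def
    using assms has_code_unique_point has_code_in_cantor_line1 by blast
  moreover have "code_of x = c"
    unfolding code_of_def using assms has_code_unique_code by blast
  ultimately show ?thesis by simp
qed

lemma Phi_point_of_Infinite:
  assumes "\<forall>c\<in>sset s. 2 \<le> c"
  shows "Phi (point_of_code (Infinite s)) = Phi_code (Infinite s)"
  using assms code_of_point_of_code[of _ "Infinite s"]
  by (simp add: Phi_def has_code_Infinite_iff del: Phi_code.simps)

lemma Phi_point_of_Terminating:
  assumes "\<forall>c\<in>set cs. 2 \<le> c"
  shows "Phi (point_of_code (Terminating cs)) = Phi_code (Terminating cs)"
  using assms code_of_point_of_code[of _ "Terminating cs"]
  by (simp add: Phi_def has_code_Terminating_iff del: Phi_code.simps)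


section \<open>The q-deformed expansion and its reduction\<close>

lemma q_number_fps_X_nth: "fps_nth (q_number (fps_X :: 'a :: comm_ring_1 fps) c) n = (if n < c then 1 else 0)"
proof -
  have "fps_nth (q_number (fps_X :: 'a fps) c) n = (\<Sum>i<c. if n = i then 1 else 0)"
    by (simp add: q_number_def fps_sum_nth fps_X_power_iff)
  then show ?thesis by simp
qed

lemma q_cfrac_nth_0:
  assumes "\<forall>c\<in>set cs. 2 \<le> c" "fps_nth e 0 = 1"
  shows "fps_nth (q_cfrac cs e) 0 = 1"
  using assms by (cases cs) (auto simp: q_number_fps_X_nth)

definition q_truncation :: "nat stream \<Rightarrow> nat \<Rightarrow> int fps" where
  "q_truncation s n = q_cfrac (stake n s) (q_number fps_X (s !! n))"

lemma q_truncation_nth_0: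
  assumes "\<forall>c\<in>sset s. 2 \<le> c"
  shows "fps_nth (q_truncation s n) 0 = 1"
proof -
  have "\<forall>c\<in>set (stake n s). 2 \<le> c" using assms set_stake_subset[of n s] by blast
  moreover have "2 \<le> s !! n" using assms by simp
  ultimately show ?thesis
    unfolding q_truncation_def by (intro q_cfrac_nth_0) (auto simp: q_number_fps_X_nth)
qed

lemma q_truncation_0: "q_truncation (c ## s) 0 = q_number fps_X c"
  by (simp add: q_truncation_def)

lemma q_truncation_Suc:
  "q_truncation (c ## s) (Suc n) =
     q_number fps_X c - fps_X ^ (c - 1) * fps_right_inverse (q_truncation s n) 1"
  by (simp add: q_truncation_def)

text \<open>
  Each level of the fraction contributes a factor \<open>q ^ (c - 1)\<close> with \<open>c \<ge> 2\<close>, so adding one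
  entry at depth \<open>n\<close> changes the value only from order \<open>n + 1\<close> on.
\<close>

lemma q_truncation_step_dvd:
  assumes "\<forall>c\<in>sset s. 2 \<le> c"
  shows "fps_X ^ Suc n dvd q_truncation s (Suc n) - q_truncation s n"
  using assms
proof (induction n arbitrary: s)
  case (0 s)
  obtain c t where s: "s = c ## t" by (cases s)
  have "(fps_X :: int fps) dvd fps_X ^ (c - 1)" using 0 by (intro dvd_power) (auto simp: s)
  then show ?case by (simp add: s q_truncation_0 q_truncation_Suc)
next
  case (Suc n s)
  obtain c t where s: "s = c ## t" by (cases s)
  have t: "\<forall>c\<in>sset t. 2 \<le> c" using Suc.prems by (simp add: s)
  let ?f = "q_truncation t (Suc n)" and ?g = "q_truncation t n"
  let ?i = "\<lambda>f :: int fps. fps_right_inverse f 1"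
  have f: "?f * ?i ?f = 1" and g: "?g * ?i ?g = 1"
    using q_truncation_nth_0[OF t] by (auto intro: fps_right_inverse)
  have "?i ?g - ?i ?f = (?f - ?g) * (?i ?f * ?i ?g)"
  proof -
    have "(?f - ?g) * (?i ?f * ?i ?g) = (?f * ?i ?f) * ?i ?g - (?g * ?i ?g) * ?i ?f"
      by (simp only: algebra_simps)
    then show ?thesis by (simp only: f g mult_1)
  qed
  moreover have "q_truncation s (Suc (Suc n)) - q_truncation s (Suc n) =
      fps_X ^ (c - 1) * (?i ?g - ?i ?f)"
    by (simp only: s q_truncation_Suc) (simp only: algebra_simps)
  ultimately have "q_truncation s (Suc (Suc n)) - q_truncation s (Suc n) =
      fps_X ^ (c - 1) * (?f - ?g) * (?i ?f * ?i ?g)"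
    by (simp only: mult.assoc)
  moreover have "(fps_X :: int fps) dvd fps_X ^ (c - 1)"
    using Suc.prems by (intro dvd_power) (auto simp: s)
  then have "fps_X * fps_X ^ Suc n dvd fps_X ^ (c - 1) * (?f - ?g)"
    using Suc.IH[OF t] by (rule mult_dvd_mono)
  ultimately show ?case by (simp only: power_Suc dvd_mult2)
qed

lemma q_truncation_nth_stable:
  assumes "\<forall>c\<in>sset s. 2 \<le> c" "i \<le> n"
  shows "fps_nth (q_truncation s n) i = fps_nth (q_truncation s i) i"
  using assms(2)
proof (induction n rule: dec_induct)
  case (step n)
  obtain h where "q_truncation s (Suc n) - q_truncation s n = fps_X ^ Suc n * h"
    using q_truncation_step_dvd[OF assms(1)] by (blast elim: dvdE)
  then have "fps_nth (q_truncation s (Suc n) - q_truncation s n) i = fps_nth (fps_X ^ Suc n * h) i"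
    by (rule arg_cong)
  also have "\<dots> = 0" using step by (simp only: fps_X_power_mult_nth) simp
  finally show ?case using step by simp
qed simp

definition q_limit :: "nat stream \<Rightarrow> int fps" where
  "q_limit s = lim (q_truncation s)"

lemma q_truncation_tendsto:
  assumes "\<forall>c\<in>sset s. 2 \<le> c"
  shows "q_truncation s \<longlonglongrightarrow> q_limit s"
proof -
  have "q_truncation s \<longlonglongrightarrow> Abs_fps (\<lambda>i. fps_nth (q_truncation s i) i)"
  proof (rule tendsto_fpsI)
    fix i
    show "\<forall>\<^sub>F n in sequentially. fps_nth (q_truncation s n) i = fps_nth (Abs_fps (\<lambda>i. fps_nth (q_truncation s i) i)) i"
      unfolding eventually_sequentially fps_nth_Abs_fps
      using q_truncation_nth_stable[OF assms] by blast
  qed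
  from this limI[OF this] show ?thesis by (simp only: q_limit_def)
qed

lemma tendsto_mult_fps:
  fixes a b :: "'a :: ring fps"
  assumes "(f \<longlongrightarrow> a) F" "(g \<longlongrightarrow> b) F"
  shows "((\<lambda>x. f x * g x) \<longlongrightarrow> a * b) F"
proof (rule tendsto_fpsI)
  fix n
  have "\<forall>\<^sub>F x in F. \<forall>i\<in>{..n}. fps_nth (f x) i = fps_nth a i \<and> fps_nth (g x) i = fps_nth b i"
    using assms by (intro eventually_ball_finite) (auto simp: tendsto_fps_iff eventually_conj_iff)
  then show "\<forall>\<^sub>F x in F. fps_nth (f x * g x) n = fps_nth (a * b) n"
    by eventually_elim (auto simp: fps_mult_nth intro!: sum.cong)
qed

lemma tendsto_diff_fps:
  fixes a b :: "'a :: ring fps"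
  assumes "(f \<longlongrightarrow> a) F" "(g \<longlongrightarrow> b) F"
  shows "((\<lambda>x. f x - g x) \<longlongrightarrow> a - b) F"
proof (rule tendsto_fpsI)
  fix n
  have "\<forall>\<^sub>F x in F. fps_nth (f x) n = fps_nth a n" "\<forall>\<^sub>F x in F. fps_nth (g x) n = fps_nth b n"
    using assms by (auto simp: tendsto_fps_iff)
  then show "\<forall>\<^sub>F x in F. fps_nth (f x - g x) n = fps_nth (a - b) n"
    by eventually_elim simp
qed

text \<open>
  Clearing the denominator of the recursion for the truncations gives an identity that passes
  to the limit because multiplication is continuous.
\<close>

lemma q_limit_SCons:
  assumes "2 \<le> c" "\<forall>d\<in>sset s. 2 \<le> d"
  shows "q_limit (c ## s) * q_limit s = q_number fps_X c * q_limit s - fps_X ^ (c - 1)"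
proof -
  have step: "q_truncation (c ## s) (Suc n) * q_truncation s n =
      q_number fps_X c * q_truncation s n - fps_X ^ (c - 1)" for n
  proof -
    let ?f = "q_truncation s n"
    have inv: "?f * fps_right_inverse ?f 1 = 1"
      using q_truncation_nth_0[OF assms(2)] by (intro fps_right_inverse) simp
    have "q_truncation (c ## s) (Suc n) * ?f =
        q_number fps_X c * ?f - fps_X ^ (c - 1) * (?f * fps_right_inverse ?f 1)"
      unfolding q_truncation_Suc by (simp only: algebra_simps)
    then show ?thesis by (simp only: inv mult_1_right)
  qed
  have "(\<lambda>n. q_number fps_X c * q_truncation s n - fps_X ^ (c - 1)) \<longlonglongrightarrow>
      q_number fps_X c * q_limit s - fps_X ^ (c - 1)"
    by (intro tendsto_diff_fps tendsto_mult_fps tendsto_const q_truncation_tendsto assms)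
  then have rhs: "(\<lambda>n. q_truncation (c ## s) (Suc n) * q_truncation s n) \<longlonglongrightarrow>
      q_number fps_X c * q_limit s - fps_X ^ (c - 1)"
    by (simp only: step)
  have "(\<lambda>n. q_truncation (c ## s) (Suc n)) \<longlonglongrightarrow> q_limit (c ## s)"
    using assms q_truncation_tendsto[of "c ## s"] by (subst filterlim_sequentially_Suc) auto
  then have "(\<lambda>n. q_truncation (c ## s) (Suc n) * q_truncation s n) \<longlonglongrightarrow>
      q_limit (c ## s) * q_limit s"
    by (intro tendsto_mult_fps q_truncation_tendsto assms)
  then show ?thesis using rhs by (rule LIMSEQ_unique)
qed

lemma q_limit_nth_0:
  assumes "\<forall>c\<in>sset s. 2 \<le> c"
  shows "fps_nth (q_limit s) 0 = 1"
proof -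
  have "\<forall>\<^sub>F n in sequentially. fps_nth (q_truncation s n) 0 = fps_nth (q_limit s) 0"
    using q_truncation_tendsto[OF assms] by (simp add: tendsto_fps_iff)
  then obtain n where "fps_nth (q_truncation s n) 0 = fps_nth (q_limit s) 0"
    by (auto simp: eventually_sequentially)
  then show ?thesis using q_truncation_nth_0[OF assms] by simp
qed

lemma reduce_fps_nth [simp]: "fps_nth (reduce_fps f) n = of_int (fps_nth f n)"
  by (simp add: reduce_fps_def)

lemma reduce_fps_1: "reduce_fps 1 = 1"
  by (simp add: fps_eq_iff)

lemma reduce_fps_diff: "reduce_fps (f - g) = reduce_fps f - reduce_fps g"
  by (simp add: fps_eq_iff)

lemma reduce_fps_mult: "reduce_fps (f * g) = reduce_fps f * reduce_fps g"
  by (simp add: fps_eq_iff fps_mult_nth)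

lemma reduce_fps_X: "reduce_fps fps_X = fps_X"
  by (simp add: fps_eq_iff fps_X_def)

lemma reduce_fps_X_power: "reduce_fps (fps_X ^ n) = fps_X ^ n"
  by (simp add: fps_eq_iff fps_X_power_iff)

lemma reduce_fps_q_number: "reduce_fps (q_number fps_X c) = q_number fps_X c"
  by (simp add: fps_eq_iff q_number_fps_X_nth)

lemma Phi_code_Infinite: "Phi_code (Infinite s) = reduce_fps (q_limit s)"
  unfolding Phi_code.simps q_limit_def q_truncation_def ..

lemma Phi_code_nth_0:
  assumes "\<forall>c\<in>sset s. 2 \<le> c"
  shows "fps_nth (Phi_code (Infinite s)) 0 = 1"
  unfolding Phi_code_Infinite using q_limit_nth_0[OF assms] by simp

lemma Phi_code_SCons:
  assumes "2 \<le> c" "\<forall>d\<in>sset s. 2 \<le> d"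
  shows "Phi_code (Infinite (c ## s)) * Phi_code (Infinite s) =
    q_number fps_X c * Phi_code (Infinite s) - fps_X ^ (c - 1)"
  unfolding Phi_code_Infinite
  using arg_cong[OF q_limit_SCons[OF assms], of reduce_fps]
  by (simp only: reduce_fps_mult reduce_fps_diff reduce_fps_X_power reduce_fps_q_number)


section \<open>Digits act by linear fractional transformations\<close>

lemma mat22_nth:
  "mat22 a b c d $ 1 $ 1 = a" "mat22 a b c d $ 1 $ 2 = b"
  "mat22 a b c d $ 2 $ 1 = c" "mat22 a b c d $ 2 $ 2 = d"
  by (simp_all add: mat22_def)

lemma M_prod_Cons_nth:
  "M_prod (c # cs) $ 1 $ j =
     q_number [:0, 1:] c * M_prod cs $ 1 $ j - [:0, 1:] ^ (c - 1) * M_prod cs $ 2 $ j"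
  "M_prod (c # cs) $ 2 $ j = M_prod cs $ 1 $ j"
  by (simp_all add: M_prod_def M_mat_def matrix_matrix_mult_def sum_2 mat22_nth)

lemma M_prod_Nil_nth:
  "M_prod [] $ 1 $ 1 = 1" "M_prod [] $ 1 $ 2 = 0" "M_prod [] $ 2 $ 1 = 0" "M_prod [] $ 2 $ 2 = 1"
  by (simp_all add: M_prod_def mat_def)

lemma fps_of_poly_q_number: "fps_of_poly (q_number [:0, 1:] c) = q_number fps_X c"
  by (simp add: q_number_def fps_of_poly_sum fps_of_poly_power)

text \<open>Each digit matrix has determinant \<open>q ^ (c - 1)\<close>.\<close>

lemma M_prod_det_nonzero:
  fixes M :: "nat list \<Rightarrow> 'a :: prime_card mod_ring poly ^ 2 ^ 2"
  defines "M \<equiv> M_prod"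
  shows "M cs $ 1 $ 1 * M cs $ 2 $ 2 - M cs $ 1 $ 2 * M cs $ 2 $ 1 \<noteq> 0"
  unfolding M_def
proof (induction cs)
  case Nil
  then show ?case by (simp add: M_prod_Nil_nth)
next
  case (Cons c cs)
  have "M_prod (c # cs) $ 1 $ 1 * M_prod (c # cs) $ 2 $ 2 -
      M_prod (c # cs) $ 1 $ 2 * M_prod (c # cs) $ 2 $ 1 =
      [:0, 1:] ^ (c - 1) *
      (M_prod cs $ 1 $ 1 * M_prod cs $ 2 $ 2 - M_prod cs $ 1 $ 2 * M_prod cs $ 2 $ 1)"
    unfolding M_prod_Cons_nth by (simp only: algebra_simps)
  moreover have "[:0, 1 :: 'a mod_ring:] ^ (c - 1) \<noteq> 0" by simp
  ultimately show ?case using Cons by (metis mult_eq_0_iff)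
qed

text \<open>
  At \<open>q = 0\<close> the matrix of a digit \<open>\<ge> 2\<close> has rows \<open>(1, 0)\<close> and \<open>(1, 0)\<close>. This matrix is idempotent, so a
  product of digit matrices has the same value at \<open>q = 0\<close>, unless it is empty.
\<close>

lemma M_prod_row_1_coeff_0:
  fixes M :: "'a :: prime_card mod_ring poly ^ 2 ^ 2"
  assumes "M = M_prod cs" "\<forall>c\<in>set cs. 2 \<le> c"
  shows "Polynomial.coeff (M $ 1 $ 1) 0 = 1" "Polynomial.coeff (M $ 1 $ 2) 0 = 0"
proof -
  have "Polynomial.coeff (M $ 1 $ 1) 0 = 1 \<and> Polynomial.coeff (M $ 1 $ 2) 0 = 0"
    using assms
  proof (induction cs arbitrary: M)
    case Nil
    then show ?case by (simp add: M_prod_Nil_nth)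
  next
    case (Cons c cs)
    have "fps_nth (fps_of_poly (q_number [:0, 1 :: 'a mod_ring:] c)) 0 = 1"
      unfolding fps_of_poly_q_number using Cons.prems by (simp add: q_number_fps_X_nth)
    moreover have "Polynomial.coeff ([:0, 1 :: 'a mod_ring:] ^ (c - 1)) 0 = 0"
      using Cons.prems by (simp add: coeff_0_power)
    moreover have "Polynomial.coeff (M_prod cs $ 1 $ 1 :: 'a mod_ring poly) 0 = 1"
      "Polynomial.coeff (M_prod cs $ 1 $ 2 :: 'a mod_ring poly) 0 = 0"
      using Cons.IH[OF refl] Cons.prems by auto
    ultimately show ?case
      unfolding Cons.prems(1) M_prod_Cons_nth by (simp add: coeff_mult_0)
  qed
  then show "Polynomial.coeff (M $ 1 $ 1) 0 = 1" "Polynomial.coeff (M $ 1 $ 2) 0 = 0"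
    by auto
qed

lemma M_prod_row_2_coeff_0:
  fixes M :: "'a :: prime_card mod_ring poly ^ 2 ^ 2"
  assumes "M = M_prod cs" "\<forall>c\<in>set cs. 2 \<le> c" "cs \<noteq> []"
  shows "Polynomial.coeff (M $ 2 $ 1) 0 = 1" "Polynomial.coeff (M $ 2 $ 2) 0 = 0"
proof -
  obtain c ds where cs: "cs = c # ds" using assms(3) by (cases cs) auto
  show "Polynomial.coeff (M $ 2 $ 1) 0 = 1" "Polynomial.coeff (M $ 2 $ 2) 0 = 0"
    using M_prod_row_1_coeff_0[OF refl, of ds] assms
    unfolding assms(1) cs M_prod_Cons_nth by auto
qed

text \<open>
  Prepending the digits \<open>cs\<close> applies the linear fractional transformation with matrix
  \<open>M_prod cs\<close>; its denominator is a unit because it has constant coefficient \<open>1\<close>.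
\<close>

lemma Phi_code_shift:
  fixes s :: "nat stream" and cs :: "nat list"
  defines "Y \<equiv> Phi_code (Infinite s) :: 'p :: prime_card mod_ring fps"
  defines "M \<equiv> \<lambda>i j. fps_of_poly (M_prod cs $ i $ j) :: 'p mod_ring fps"
  assumes "\<forall>c\<in>set cs. 2 \<le> c" "\<forall>c\<in>sset s. 2 \<le> c"
  shows "Phi_code (Infinite (cs @- s)) * (M 2 1 * Y + M 2 2) = M 1 1 * Y + M 1 2"
    and "fps_nth (M 2 1 * Y + M 2 2) 0 = 1"
  using assms(3) unfolding M_def
proof (induction cs)
  case Nil
  {
    case 1
    then show ?case by (simp add: M_prod_Nil_nth Y_def)
  next
    case 2
    then show ?case by (simp add: M_prod_Nil_nth)
  }
next
  case (Cons c cs)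
  let ?N = "\<lambda>i j. fps_of_poly (M_prod cs $ i $ j) :: 'p mod_ring fps"
  let ?Z = "Phi_code (Infinite (cs @- s)) :: 'p mod_ring fps"
  let ?Z' = "Phi_code (Infinite ((c # cs) @- s)) :: 'p mod_ring fps"
  {
    case 1
    have IH: "?Z * (?N 2 1 * Y + ?N 2 2) = ?N 1 1 * Y + ?N 1 2" using Cons.IH(1) 1 by simp
    have step: "?Z' * ?Z = q_number fps_X c * ?Z - fps_X ^ (c - 1)"
      using 1 assms(4) Phi_code_SCons[of c "cs @- s"]
      by (simp del: Phi_code.simps add: ball_Un)
    have "?Z' * (?N 1 1 * Y + ?N 1 2) = (?Z' * ?Z) * (?N 2 1 * Y + ?N 2 2)"
      by (simp only: IH[symmetric] mult.assoc)
    also have "\<dots> = q_number fps_X c * (?Z * (?N 2 1 * Y + ?N 2 2)) -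
        fps_X ^ (c - 1) * (?N 2 1 * Y + ?N 2 2)"
      by (simp only: step left_diff_distrib mult.assoc)
    finally have "?Z' * (?N 1 1 * Y + ?N 1 2) =
        q_number fps_X c * (?N 1 1 * Y + ?N 1 2) - fps_X ^ (c - 1) * (?N 2 1 * Y + ?N 2 2)"
      by (simp only: IH)
    then show ?case
      by (simp del: Phi_code.simps add: M_prod_Cons_nth fps_of_poly_diff fps_of_poly_mult
          fps_of_poly_q_number fps_of_poly_power algebra_simps)
  next
    case 2
    have "?Z * (?N 2 1 * Y + ?N 2 2) = ?N 1 1 * Y + ?N 1 2" using Cons.IH(1) 2 by simp
    then have "fps_nth (?N 1 1 * Y + ?N 1 2) 0 = fps_nth ?Z 0 * fps_nth (?N 2 1 * Y + ?N 2 2) 0"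
      by (metis fps_mult_nth_0)
    also have "\<dots> = 1"
      using Cons.IH(2) 2 assms(4) Phi_code_nth_0[of "cs @- s"]
      by (simp del: Phi_code.simps add: ball_Un)
    finally show ?case by (simp add: M_prod_Cons_nth)
  }
qed


section \<open>Quadratic elements over a subfield\<close>

locale subfield =
  fixes K :: "'a :: field set"
  assumes one_in: "1 \<in> K"
    and diff_in: "x \<in> K \<Longrightarrow> y \<in> K \<Longrightarrow> x - y \<in> K"
    and divide_in: "x \<in> K \<Longrightarrow> y \<in> K \<Longrightarrow> x / y \<in> K"
begin

lemma zero_in: "0 \<in> K"
  using diff_in[OF one_in one_in] by simp

lemma uminus_in: "x \<in> K \<Longrightarrow> - x \<in> K"
  using diff_in[OF zero_in] by simp

lemma add_in: "x \<in> K \<Longrightarrow> y \<in> K \<Longrightarrow> x + y \<in> K"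
  using diff_in[of x "- y"] uminus_in[of y] by simp

lemma mult_in: "x \<in> K \<Longrightarrow> y \<in> K \<Longrightarrow> x * y \<in> K"
  using divide_in[of x "1 / y"] divide_in[OF one_in, of y] by simp

lemma two_in: "2 \<in> K"
  using add_in[OF one_in one_in] by simp

lemmas closed = zero_in one_in two_in uminus_in add_in diff_in mult_in divide_in

text \<open>A quadratic with one root \<open>y\<close> in \<open>K\<close> has its other root \<open>- \<beta> / \<alpha> - y\<close> in \<open>K\<close> too.\<close>

lemma quadratic_splits_iff_root_in:
  assumes "\<alpha> \<noteq> 0" "\<alpha> \<in> K" "\<beta> \<in> K" "\<alpha> * y\<^sup>2 + \<beta> * y + \<gamma> = 0"
  shows "splits_over K [:\<gamma>, \<beta>, \<alpha>:] \<longleftrightarrow> y \<in> K"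
proof
  assume "splits_over K [:\<gamma>, \<beta>, \<alpha>:]"
  then obtain a rs where rs: "set rs \<subseteq> K"
    and eq: "[:\<gamma>, \<beta>, \<alpha>:] = Polynomial.smult a (\<Prod>r\<leftarrow>rs. [:- r, 1:])"
    unfolding splits_over_def by blast
  have "a \<noteq> 0" using eq assms(1) by auto
  have "poly [:\<gamma>, \<beta>, \<alpha>:] y = 0"
    using assms(4) by (simp add: algebra_simps power2_eq_square)
  then have "a * (\<Prod>r\<leftarrow>rs. y - r) = 0"
    unfolding eq by (simp add: poly_prod_list o_def)
  then have "y \<in> set rs" using \<open>a \<noteq> 0\<close> by (auto simp: prod_list_zero_iff)
  then show "y \<in> K" using rs by blast
next
  assume y: "y \<in> K"
  define z where "z = - \<beta> / \<alpha> - y"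
  have "z \<in> K" unfolding z_def by (intro closed assms y)
  have \<beta>: "\<beta> = - \<alpha> * (y + z)" using assms(1) by (simp add: z_def field_simps)
  have "\<gamma> = - (\<alpha> * y\<^sup>2 + \<beta> * y)" using assms(4) by (simp only: add_eq_0_iff)
  also have "\<dots> = \<alpha> * (y * z)" unfolding \<beta> by (simp add: algebra_simps power2_eq_square)
  finally have "\<gamma> = \<alpha> * (y * z)" .
  with \<beta> have "[:\<gamma>, \<beta>, \<alpha>:] = Polynomial.smult \<alpha> (\<Prod>r\<leftarrow>[y, z]. [:- r, 1:])"
    by (simp add: algebra_simps)
  then show "splits_over K [:\<gamma>, \<beta>, \<alpha>:]"
    unfolding splits_over_def using y \<open>z \<in> K\<close> assms(2)
    by (intro exI[of _ \<alpha>] exI[of _ "[y, z]"]) simp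
qed

lemma has_degree_2:
  assumes "\<alpha> \<noteq> 0" "\<alpha> \<in> K" "\<beta> \<in> K" "\<gamma> \<in> K" "\<alpha> * y\<^sup>2 + \<beta> * y + \<gamma> = 0" "y \<notin> K"
  shows "has_degree_over K y 2"
proof -
  let ?f = "[:\<gamma> / \<alpha>, \<beta> / \<alpha>, 1:]"
  have "poly ?f y = (\<alpha> * y\<^sup>2 + \<beta> * y + \<gamma>) / \<alpha>"
    using assms(1) by (simp add: field_simps power2_eq_square)
  then have root: "poly ?f y = 0" by (simp only: assms(5) div_0)
  have minimal: "2 \<le> Polynomial.degree g"
    if g: "g \<noteq> 0" "set (Polynomial.coeffs g) \<subseteq> K" "poly g y = 0" for g
  proof (rule ccontr)
    assume "\<not> 2 \<le> Polynomial.degree g"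
    define a b where "a = Polynomial.coeff g 1" and "b = Polynomial.coeff g 0"
    have "Polynomial.coeff g (Suc (Suc m)) = 0" for m
      using \<open>\<not> 2 \<le> Polynomial.degree g\<close> by (intro coeff_eq_0) simp
    then have "Polynomial.coeff g n = Polynomial.coeff [:b, a:] n" for n
      unfolding a_def b_def by (cases n rule: nat.exhaust; cases "n - 1") simp_all
    then have g_eq: "g = [:b, a:]" by (rule poly_eqI)
    have "Polynomial.coeff g i \<in> K" for i
    proof -
      have "Polynomial.coeff g i \<in> insert 0 (set (Polynomial.coeffs g))"
        unfolding range_coeff[symmetric] by simp
      then show ?thesis using g(2) zero_in by auto
    qed
    then have "b \<in> K" "a \<in> K" by (simp_all only: a_def b_def)
    show False
    proof (cases "a = 0")
      case True
      then show ?thesis using g by (simp add: g_eq)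
    next
      case False
      have "b + y * a = 0" using g(3) by (simp add: g_eq)
      then have "y * a = - b" by (simp only: add_eq_0_iff)
      then have "y = - b / a" using False by (simp only: eq_divide_eq simp_thms if_True)
      moreover have "- b / a \<in> K"
        by (intro divide_in uminus_in \<open>a \<in> K\<close> \<open>b \<in> K\<close>)
      ultimately show ?thesis using assms(6) by simp
    qed
  qed
  have in_K: "set (Polynomial.coeffs ?f) \<subseteq> K"
    using assms(2-4) one_in divide_in by (simp add: cCons_def)
  have deg: "Polynomial.degree ?f = 2" by simp
  have "Polynomial.lead_coeff ?f = 1" by simp
  then have "is_min_poly K y ?f"
    unfolding is_min_poly_def deg using root minimal in_K by blast
  then show ?thesis unfolding has_degree_over_def using deg by blast
qed

lemma moebius_inverse:
  fixes a b c d w y :: 'a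
  assumes "w * (c * y + d) = a * y + b"
  shows "(a - c * w) * (c * y + d) = a * d - b * c"
    and "(d * w - b) * (c * y + d) = (a * d - b * c) * y"
proof -
  have "(a - c * w) * (c * y + d) = a * (c * y + d) - c * (w * (c * y + d))"
    "(d * w - b) * (c * y + d) = d * (w * (c * y + d)) - b * (c * y + d)"
    by (simp_all add: algebra_simps)
  then show "(a - c * w) * (c * y + d) = a * d - b * c"
    "(d * w - b) * (c * y + d) = (a * d - b * c) * y"
    unfolding assms by (simp_all add: algebra_simps)
qed

text \<open>
  The inverse transformation \<open>y = (d w - b) / (a - c w)\<close> is defined at \<open>w\<close>, because its
  denominator is \<open>(a d - b c) / (c y + d)\<close>.
\<close>

lemma moebius_in_iff:
  assumes "a \<in> K" "b \<in> K" "c \<in> K" "d \<in> K" "a * d - b * c \<noteq> 0"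
    and "c * y + d \<noteq> 0" "w * (c * y + d) = a * y + b"
  shows "w \<in> K \<longleftrightarrow> y \<in> K"
proof
  assume w: "w \<in> K"
  have "a - c * w \<noteq> 0" using moebius_inverse(1)[OF assms(7)] assms(5) by auto
  moreover have "y * (a - c * w) = d * w - b" using assms(7) by (simp add: algebra_simps)
  ultimately have "y = (d * w - b) / (a - c * w)" by (simp add: field_simps)
  moreover have "(d * w - b) / (a - c * w) \<in> K" by (intro closed assms w)
  ultimately show "y \<in> K" by simp
next
  assume y: "y \<in> K"
  have "w = (a * y + b) / (c * y + d)" using assms(6,7) by (simp add: field_simps)
  moreover have "(a * y + b) / (c * y + d) \<in> K" by (intro closed assms y)
  ultimately show "w \<in> K" by simp
qed

text \<open>
  Substituting \<open>y = (d w - b) / (a - c w)\<close> in the equation of \<open>y\<close> gives a quadratic equation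
  for \<open>w\<close>. Its leading coefficient vanishes only if \<open>- d / c\<close>, the point sent to infinity, is a
  root of the equation of \<open>y\<close>; but then that equation splits.
\<close>

lemma moebius_has_degree_2:
  assumes "a \<in> K" "b \<in> K" "c \<in> K" "d \<in> K" "a * d - b * c \<noteq> 0"
    and "c * y + d \<noteq> 0" "w * (c * y + d) = a * y + b"
    and "\<alpha> \<noteq> 0" "\<alpha> \<in> K" "\<beta> \<in> K" "\<gamma> \<in> K" "\<alpha> * y\<^sup>2 + \<beta> * y + \<gamma> = 0" "y \<notin> K"
  shows "has_degree_over K w 2"
proof (rule has_degree_2)
  let ?\<alpha> = "\<alpha> * d\<^sup>2 - \<beta> * c * d + \<gamma> * c\<^sup>2"
  let ?\<beta> = "\<beta> * (a * d + b * c) - 2 * \<alpha> * b * d - 2 * \<gamma> * a * c"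
  let ?\<gamma> = "\<alpha> * b\<^sup>2 - \<beta> * a * b + \<gamma> * a\<^sup>2"
  show "?\<alpha> \<in> K" "?\<beta> \<in> K" "?\<gamma> \<in> K"
    unfolding power2_eq_square by (intro closed assms)+
  show "w \<notin> K" using moebius_in_iff[OF assms(1-7)] assms(13) by simp
  show "?\<alpha> \<noteq> 0"
  proof
    assume 0: "?\<alpha> = 0"
    show False
    proof (cases "c = 0")
      case True
      then show ?thesis using 0 assms(5,8) by simp
    next
      case False
      have "\<alpha> * (- d / c)\<^sup>2 + \<beta> * (- d / c) + \<gamma> = ?\<alpha> / c\<^sup>2"
        using False by (simp add: field_simps power2_eq_square)
      then have "\<alpha> * (- d / c)\<^sup>2 + \<beta> * (- d / c) + \<gamma> = 0" using 0 by simp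
      moreover have "- d / c \<in> K" by (intro closed assms)
      ultimately have "splits_over K [:\<gamma>, \<beta>, \<alpha>:]"
        using quadratic_splits_iff_root_in assms(8-10) by blast
      then show False using quadratic_splits_iff_root_in assms(8-10,12,13) by blast
    qed
  qed
  let ?t = "c * y + d"
  have "?\<alpha> * w\<^sup>2 + ?\<beta> * w + ?\<gamma> =
      \<alpha> * (d * w - b)\<^sup>2 + \<beta> * ((d * w - b) * (a - c * w)) + \<gamma> * (a - c * w)\<^sup>2"
    by (simp add: algebra_simps power2_eq_square)
  then have "(?\<alpha> * w\<^sup>2 + ?\<beta> * w + ?\<gamma>) * ?t\<^sup>2 =
      (\<alpha> * (d * w - b)\<^sup>2 + \<beta> * ((d * w - b) * (a - c * w)) + \<gamma> * (a - c * w)\<^sup>2) * ?t\<^sup>2"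
    by (rule arg_cong)
  also have "\<dots> = \<alpha> * ((d * w - b) * ?t)\<^sup>2 + \<beta> * (((d * w - b) * ?t) * ((a - c * w) * ?t)) +
      \<gamma> * ((a - c * w) * ?t)\<^sup>2"
    unfolding power_mult_distrib distrib_right by (simp only: power2_eq_square mult_ac)
  also have "\<dots> = (a * d - b * c)\<^sup>2 * (\<alpha> * y\<^sup>2 + \<beta> * y + \<gamma>)"
    unfolding moebius_inverse[OF assms(7)] by (simp only: algebra_simps power2_eq_square)
  finally have "(?\<alpha> * w\<^sup>2 + ?\<beta> * w + ?\<gamma>) * ?t\<^sup>2 =
      (a * d - b * c)\<^sup>2 * (\<alpha> * y\<^sup>2 + \<beta> * y + \<gamma>)" .
  then have "(?\<alpha> * w\<^sup>2 + ?\<beta> * w + ?\<gamma>) * ?t\<^sup>2 = 0"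
    by (simp only: assms(12) mult_zero_right)
  then show "?\<alpha> * w\<^sup>2 + ?\<beta> * w + ?\<gamma> = 0"
    using assms(6) by (simp only: mult_eq_0_iff power_eq_0_iff simp_thms)
qed

text \<open>The discriminant is the square of \<open>2 \<alpha> y + \<beta>\<close>.\<close>

lemma root_in_iff_discriminant_square:
  assumes "(2 :: 'a) \<noteq> 0" "\<alpha> \<noteq> 0" "\<alpha> \<in> K" "\<beta> \<in> K" "\<alpha> * y\<^sup>2 + \<beta> * y + \<gamma> = 0"
  shows "y \<in> K \<longleftrightarrow> (\<exists>u\<in>K. \<beta>\<^sup>2 - 4 * \<alpha> * \<gamma> = u\<^sup>2)"
proof
  have disc: "\<beta>\<^sup>2 - 4 * \<alpha> * \<gamma> = (2 * \<alpha> * y + \<beta>)\<^sup>2"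
  proof -
    have "(2 * \<alpha> * y + \<beta>)\<^sup>2 = 4 * \<alpha> * (\<alpha> * y\<^sup>2 + \<beta> * y + \<gamma>) + (\<beta>\<^sup>2 - 4 * \<alpha> * \<gamma>)"
      by (simp add: algebra_simps power2_eq_square)
    then show ?thesis by (simp only: assms(5)) simp
  qed
  {
    assume y: "y \<in> K"
    have "2 * \<alpha> * y + \<beta> \<in> K" by (intro closed assms y)
    with disc show "\<exists>u\<in>K. \<beta>\<^sup>2 - 4 * \<alpha> * \<gamma> = u\<^sup>2" by blast
  next
    assume "\<exists>u\<in>K. \<beta>\<^sup>2 - 4 * \<alpha> * \<gamma> = u\<^sup>2"
    then obtain u where u: "u \<in> K" "(2 * \<alpha> * y + \<beta>)\<^sup>2 = u\<^sup>2" using disc by auto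
    then have in_K: "2 * \<alpha> * y + \<beta> \<in> K" unfolding power2_eq_iff using uminus_in by auto
    have "(2 * \<alpha> * y + \<beta> - \<beta>) / (2 * \<alpha>) \<in> K"
      by (intro divide_in diff_in mult_in two_in in_K assms)
    then show "y \<in> K" using assms(1,2) by simp
  }
qed

text \<open>
  In characteristic two the substitution \<open>u = \<alpha> y / \<beta>\<close> turns the equation into the
  Artin--Schreier equation \<open>u\<^sup>2 + u = \<alpha> \<gamma> / \<beta>\<^sup>2\<close>, whose solutions differ by \<open>1\<close>.
\<close>

lemma root_in_iff_artin_schreier:
  assumes "(2 :: 'a) = 0" "\<alpha> \<noteq> 0" "\<beta> \<noteq> 0" "\<alpha> \<in> K" "\<beta> \<in> K" "\<alpha> * y\<^sup>2 + \<beta> * y + \<gamma> = 0"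
  shows "y \<in> K \<longleftrightarrow> \<alpha> * \<gamma> / \<beta>\<^sup>2 \<in> {u\<^sup>2 + u | u. u \<in> K}"
proof -
  define v where "v = \<alpha> * y / \<beta>"
  have neg: "- x = x" for x :: 'a
  proof (rule minus_unique)
    show "x + x = 0" unfolding mult_2[symmetric] assms(1) by simp
  qed
  have "v\<^sup>2 + v = \<alpha> * (\<alpha> * y\<^sup>2 + \<beta> * y) / \<beta>\<^sup>2"
    using assms(3) by (simp add: v_def field_simps power2_eq_square)
  also have "\<alpha> * y\<^sup>2 + \<beta> * y = \<gamma>"
    using assms(6) unfolding add_eq_0_iff neg by (rule sym)
  finally have v: "v\<^sup>2 + v = \<alpha> * \<gamma> / \<beta>\<^sup>2" .
  have "y \<in> K \<longleftrightarrow> v \<in> K"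
  proof
    show "v \<in> K" if "y \<in> K" unfolding v_def by (intro closed assms that)
    show "y \<in> K" if "v \<in> K"
    proof -
      have "v * \<beta> / \<alpha> \<in> K" by (intro closed assms that)
      then show ?thesis using assms(2,3) by (simp add: v_def)
    qed
  qed
  also have "\<dots> \<longleftrightarrow> v\<^sup>2 + v \<in> {u\<^sup>2 + u | u. u \<in> K}"
  proof
    assume "v\<^sup>2 + v \<in> {u\<^sup>2 + u | u. u \<in> K}"
    then obtain u where u: "u \<in> K" "v\<^sup>2 + v = u\<^sup>2 + u" by blast
    have "(v - u) * (v - (- u - 1)) = (v\<^sup>2 + v) - (u\<^sup>2 + u)"
      by (simp add: algebra_simps power2_eq_square)
    also have "\<dots> = 0" by (simp only: u diff_self)
    finally have "(v - u) * (v - (- u - 1)) = 0" .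
    then have "v = u \<or> v = - u - 1" by (simp only: mult_eq_0_iff right_minus_eq)
    moreover have "- u - 1 \<in> K" by (intro closed u)
    ultimately show "v \<in> K" using u(1) by metis
  next
    assume "v \<in> K"
    then show "v\<^sup>2 + v \<in> {u\<^sup>2 + u | u. u \<in> K}" 
      by (intro CollectI exI[of _ v]) simp
  qed
  finally show ?thesis unfolding v .
qed

end


section \<open>Rational functions\<close>

lemma fls_of_poly_mult: "fls_of_poly (f * g) = fls_of_poly f * fls_of_poly g"
  by (simp add: fps_of_poly_mult fls_times_fps_to_fls)

lemma fls_of_poly_power: "fls_of_poly (f ^ n) = fls_of_poly f ^ n"
  by (simp add: fps_of_poly_power fps_to_fls_power)

lemma fls_of_poly_diff: "fls_of_poly (f - g) = fls_of_poly f - fls_of_poly g"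
  by (simp add: fps_of_poly_diff)

lemma fls_of_poly_add: "fls_of_poly (f + g) = fls_of_poly f + fls_of_poly g"
  by (simp add: fps_of_poly_add)

lemma fls_of_poly_eq_0_iff: "fls_of_poly f = 0 \<longleftrightarrow> f = 0"
  using fps_of_poly_eq_iff[of f 0] by simp

lemma rat_funsI: "g \<noteq> 0 \<Longrightarrow> x = fls_of_poly f / fls_of_poly g \<Longrightarrow> x \<in> rat_funs"
  unfolding rat_funs_def by blast

lemma fls_of_poly_in_rat_funs: "fls_of_poly f \<in> rat_funs"
  unfolding rat_funs_def by (intro CollectI exI[of _ f] exI[of _ 1]) simp

interpretation rat_funs: subfield "rat_funs :: 'a :: field fls set"
proof
  show "1 \<in> (rat_funs :: 'a fls set)"
    using fls_of_poly_in_rat_funs[of 1] by simp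
next
  fix x y :: "'a fls"
  assume "x \<in> rat_funs" "y \<in> rat_funs"
  then obtain a b c d :: "'a poly" where "b \<noteq> 0" "d \<noteq> 0"
    and x: "x = fls_of_poly a / fls_of_poly b" and y: "y = fls_of_poly c / fls_of_poly d"
    unfolding rat_funs_def by blast
  then have nz: "fls_of_poly b \<noteq> 0" "fls_of_poly d \<noteq> 0" by (simp_all only: fls_of_poly_eq_0_iff not_False_eq_True)
  have "x - y = fls_of_poly (a * d - c * b) / fls_of_poly (b * d)"
    unfolding fls_of_poly_diff fls_of_poly_mult x y using nz by (rule diff_frac_eq)
  then show "x - y \<in> rat_funs"
    using \<open>b \<noteq> 0\<close> \<open>d \<noteq> 0\<close> by (intro rat_funsI) auto
  show "x / y \<in> rat_funs"
  proof (cases "c = 0")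
    case True
    then have "y = 0" by (simp add: y)
    then have "x / y = fls_of_poly 0" by simp
    then show ?thesis by (simp only: fls_of_poly_in_rat_funs)
  next
    case False
    have "x / y = fls_of_poly (a * d) / fls_of_poly (b * c)"
      unfolding fls_of_poly_mult x y by (simp only: divide_divide_times_eq)
    then show ?thesis
      using \<open>b \<noteq> 0\<close> False by (intro rat_funsI) auto
  qed
qed

lemma inverse_in_rat_funs:
  assumes "f * g = 1" "fps_to_fls f \<in> rat_funs"
  shows "fps_to_fls g \<in> rat_funs"
proof -
  have "fps_to_fls f * fps_to_fls g = 1"
    using arg_cong[OF assms(1), of fps_to_fls] by (simp add: fls_times_fps_to_fls)
  then have "inverse (fps_to_fls f) = fps_to_fls g"
    by (rule inverse_unique)
  then show ?thesis
    using rat_funs.divide_in[OF rat_funs.one_in assms(2)] by (simp only: inverse_eq_divide)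
qed


section \<open>Terminating codes\<close>

lemma q_number_in_rat_funs: "fps_to_fls (q_number fps_X c) \<in> rat_funs"
  using fls_of_poly_in_rat_funs[of "q_number [:0, 1:] c"] by (simp add: fps_of_poly_q_number)

lemma fps_X_power_in_rat_funs: "fps_to_fls (fps_X ^ n) \<in> rat_funs"
  using fls_of_poly_in_rat_funs[of "[:0, 1:] ^ n"] by (simp add: fps_of_poly_power)

lemma reduce_q_cfrac_in_rat_funs:
  fixes e :: "int fps"
  assumes "\<forall>c\<in>set cs. 2 \<le> c" "fps_nth e 0 = 1"
    and "fps_to_fls (reduce_fps e :: 'p :: prime_card mod_ring fps) \<in> rat_funs"
  shows "fps_to_fls (reduce_fps (q_cfrac cs e) :: 'p mod_ring fps) \<in> rat_funs"
  using assms(1)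
proof (induction cs)
  case Nil
  then show ?case using assms(3) by simp
next
  case (Cons c cs)
  let ?f = "q_cfrac cs e"
  let ?g = "fps_right_inverse ?f 1"
  have "?f * ?g = 1"
    using Cons.prems q_cfrac_nth_0[of cs e] assms(2) by (intro fps_right_inverse) simp
  then have "reduce_fps ?f * reduce_fps ?g = (1 :: 'p mod_ring fps)"
    by (simp only: reduce_fps_mult[symmetric] reduce_fps_1)
  then have "fps_to_fls (reduce_fps ?g :: 'p mod_ring fps) \<in> rat_funs"
    by (rule inverse_in_rat_funs) (use Cons in simp)
  then show ?case
    unfolding q_cfrac.simps reduce_fps_diff reduce_fps_mult reduce_fps_q_number reduce_fps_X_power
      fps_to_fls_minus fls_times_fps_to_fls
    by (intro rat_funs.diff_in rat_funs.mult_in q_number_in_rat_funs fps_X_power_in_rat_funs)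
qed

lemma Phi_code_Terminating_in_rat_funs:
  assumes "\<forall>c\<in>set cs. 2 \<le> c"
  shows "fps_to_fls (Phi_code (Terminating cs) :: 'p :: prime_card mod_ring fps) \<in> rat_funs"
proof -
  have X1: "fps_to_fls (1 - fps_X :: 'p mod_ring fps) \<in> rat_funs"
    using rat_funs.diff_in[OF rat_funs.one_in fps_X_power_in_rat_funs[of 1]] by simp
  show ?thesis
  proof (cases "cs = []")
    case True
    have "(1 - fps_X :: 'p mod_ring fps) * inverse (1 - fps_X) = 1"
      by (rule inverse_mult_eq_1') simp
    then show ?thesis using True inverse_in_rat_funs[OF _ X1] by simp
  next
    case False
    define e :: "int fps" where
      "e = q_number fps_X (last cs) - fps_X ^ (last cs - 1) * (1 - fps_X)"
    have "2 \<le> last cs" using assms False by simp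
    then have "fps_nth e 0 = 1"
      by (simp add: e_def q_number_fps_X_nth)
    moreover have "fps_to_fls (reduce_fps e :: 'p mod_ring fps) \<in> rat_funs"
      unfolding e_def reduce_fps_diff reduce_fps_mult reduce_fps_q_number reduce_fps_X_power
        reduce_fps_1 reduce_fps_X fps_to_fls_minus[of "q_number _ _"] fls_times_fps_to_fls
      by (intro rat_funs.diff_in rat_funs.mult_in q_number_in_rat_funs fps_X_power_in_rat_funs X1)
    moreover have "\<forall>c\<in>set (butlast cs). 2 \<le> c" using assms by (auto dest: in_set_butlastD)
    ultimately show ?thesis
      using False reduce_q_cfrac_in_rat_funs[of "butlast cs" e] by (simp add: e_def)
  qed
qed


section \<open>Periodic codes\<close>

lemma sset_cycle_ge_2:
  assumes "cs \<noteq> []" "\<forall>c\<in>set cs. 2 \<le> c"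
  shows "\<forall>c\<in>sset (cycle cs). (2 :: nat) \<le> c"
  using assms by simp

text \<open>
  A purely periodic code is fixed by prepending its period, so its image is a fixed point of
  the linear fractional transformation of the period.
\<close>

lemma Phi_code_cycle_equation:
  fixes Y :: "'p :: prime_card mod_ring fps"
  assumes "cs \<noteq> []" "\<forall>c\<in>set cs. 2 \<le> c" "M_prod cs = mat22 A B C D"
    and "Y = Phi_code (Infinite (cycle cs))"
  shows "fps_of_poly C * Y\<^sup>2 + fps_of_poly (D - A) * Y - fps_of_poly B = 0"
proof -
  have "Y * (fps_of_poly C * Y + fps_of_poly D) = fps_of_poly A * Y + fps_of_poly B"
    using Phi_code_shift(1)[OF assms(2) sset_cycle_ge_2[OF assms(1,2)], where 'p = 'p]
    unfolding cycle_decomp[OF assms(1), symmetric] assms(3) mat22_nth assms(4)[symmetric] .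
  then have "Y * (fps_of_poly C * Y + fps_of_poly D) - (fps_of_poly A * Y + fps_of_poly B) = 0"
    by simp
  then show ?thesis
    by (simp add: fps_of_poly_diff algebra_simps power2_eq_square)
qed

text \<open>
  The difference of two solutions \<open>Y\<close> and \<open>Z\<close> is annihilated by \<open>C (Y + Z) + D - A\<close>, whose
  constant coefficient is \<open>2 + 0 - 1 = 1\<close>.
\<close>

lemma cycle_equation_unique:
  fixes Y Z :: "'p :: prime_card mod_ring fps"
  assumes "cs \<noteq> []" "\<forall>c\<in>set cs. 2 \<le> c" "M_prod cs = mat22 A B C D"
    and "fps_nth Y 0 = 1" "fps_of_poly C * Y\<^sup>2 + fps_of_poly (D - A) * Y - fps_of_poly B = 0"
    and "fps_nth Z 0 = 1" "fps_of_poly C * Z\<^sup>2 + fps_of_poly (D - A) * Z - fps_of_poly B = 0"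
  shows "Y = Z"
proof -
  let ?h = "fps_of_poly C * (Y + Z) + fps_of_poly (D - A)"
  have "(Y - Z) * ?h = (fps_of_poly C * Y\<^sup>2 + fps_of_poly (D - A) * Y - fps_of_poly B) -
      (fps_of_poly C * Z\<^sup>2 + fps_of_poly (D - A) * Z - fps_of_poly B)"
    by (simp add: algebra_simps power2_eq_square)
  also have "\<dots> = 0" unfolding assms(5,7) by simp
  finally have "(Y - Z) * ?h = 0" .
  moreover have "Polynomial.coeff A 0 = 1" "Polynomial.coeff C 0 = 1" "Polynomial.coeff D 0 = 0"
    using M_prod_row_1_coeff_0[OF assms(3)[symmetric] assms(2)]
      M_prod_row_2_coeff_0[OF assms(3)[symmetric] assms(2,1)] by (simp_all add: mat22_nth)
  then have "fps_nth ?h 0 = 1" using assms(4,6) by simp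
  then have "?h \<noteq> 0" by (metis fps_zero_nth zero_neq_one)
  ultimately show "Y = Z" by simp
qed

lemma fps_constant_coeff_1_iff:
  "f \<in> {1 + fps_X * g | g. True} \<longleftrightarrow> fps_nth f 0 = (1 :: 'a :: comm_ring_1)"
proof
  assume "fps_nth f 0 = 1"
  then have "f = 1 + fps_X * fps_shift 1 f"
    by (simp add: fps_eq_iff fps_X_mult_nth)
  then show "f \<in> {1 + fps_X * g | g. True}" by blast
qed auto

lemma two_fls_eq_0_iff: "(2 :: 'a :: comm_ring_1 fls) = 0 \<longleftrightarrow> (2 :: 'a) = 0"
proof
  assume "(2 :: 'a fls) = 0"
  then have "fls_nth (2 :: 'a fls) 0 = 0" by simp
  then show "(2 :: 'a) = 0" by simp
next
  assume "(2 :: 'a) = 0"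
  then have "fls_const (2 :: 'a) = 0" by simp
  then show "(2 :: 'a fls) = 0" by simp
qed

lemma two_mod_ring_eq_0_iff: "(2 :: 'p :: prime_card mod_ring) = 0 \<longleftrightarrow> CARD('p) = 2"
proof
  assume "CARD('p) = 2"
  then show "(2 :: 'p mod_ring) = 0"
    using of_nat_card_eq_0[where 'a = 'p] by simp
next
  assume two: "(2 :: 'p mod_ring) = 0"
  have "even (CARD('p))"
  proof (rule ccontr)
    assume "odd (CARD('p))"
    then obtain k where "CARD('p) = 2 * k + 1" by (elim oddE)
    then have "(of_nat (2 * k + 1) :: 'p mod_ring) = 0"
      using of_nat_card_eq_0[where 'a = 'p] by simp
    moreover have "(of_nat (2 * k + 1) :: 'p mod_ring) = 2 * of_nat k + 1" by simp
    ultimately show False using two by simp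
  qed
  then show "CARD('p) = 2" using prime_card[where 'a = 'p] two_is_prime_nat primes_dvd_imp_eq by metis
qed

theorem proposition8p3:
  fixes p :: nat
  assumes "CARD('p :: prime_card) = p"
  shows
    "(\<forall>bs cs x (Y :: 'p mod_ring fps) A B C D P.
        (\<forall>a \<in> set bs \<union> set cs. 2 \<le> a) \<and> cs \<noteq> [] \<and>
        x = point_of_code (Infinite (bs @- cycle cs)) \<and>
        M_prod cs = mat22 A B C D \<and>
        Y = Phi (point_of_code (Infinite (cycle cs))) \<and>
        P = [:- fls_of_poly B, fls_of_poly (D - A), fls_of_poly C:] \<longrightarrow>
        (\<forall>Z. Z \<in> {1 + fps_X * f | f. True} \<and>
             fps_of_poly C * Z\<^sup>2 + fps_of_poly (D - A) * Z - fps_of_poly B = 0 \<longleftrightarrow> Z = Y) \<and>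
        (fps_to_fls (Phi x :: 'p mod_ring fps) \<in> rat_funs \<longleftrightarrow> splits_over rat_funs P) \<and>
        (\<not> splits_over rat_funs P \<longrightarrow>
           has_degree_over rat_funs (fps_to_fls (Phi x :: 'p mod_ring fps)) 2) \<and>
        (odd p \<longrightarrow>
           (splits_over rat_funs P \<longleftrightarrow>
            (\<exists>u \<in> rat_funs. fls_of_poly ((D - A)\<^sup>2 + 4 * B * C) = u\<^sup>2))) \<and>
        (p = 2 \<longrightarrow>
           (splits_over rat_funs P \<longleftrightarrow>
            fls_of_poly (B * C) / fls_of_poly ((A + D)\<^sup>2) \<in> {u\<^sup>2 + u | u. u \<in> rat_funs}))) \<and>
     (\<forall>bs. (\<forall>a \<in> set bs. 2 \<le> a) \<longrightarrow>
        fps_to_fls (Phi (point_of_code (Terminating bs)) :: 'p mod_ring fps) \<in> rat_funs)"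
proof (intro conjI allI impI)
  fix bs :: "nat list"
  assume "\<forall>a\<in>set bs. 2 \<le> a"
  then show "fps_to_fls (Phi (point_of_code (Terminating bs)) :: 'p mod_ring fps) \<in> rat_funs"
    by (simp only: Phi_point_of_Terminating Phi_code_Terminating_in_rat_funs)
next
  fix bs cs :: "nat list" and x and Y :: "'p mod_ring fps"
    and A B C D :: "'p mod_ring poly" and P
  assume *: "(\<forall>a \<in> set bs \<union> set cs. 2 \<le> a) \<and> cs \<noteq> [] \<and>
        x = point_of_code (Infinite (bs @- cycle cs)) \<and>
        M_prod cs = mat22 A B C D \<and>
        Y = Phi (point_of_code (Infinite (cycle cs))) \<and>
        P = [:- fls_of_poly B, fls_of_poly (D - A), fls_of_poly C:]"
  then have bs: "\<forall>c\<in>set bs. 2 \<le> c" and cs: "cs \<noteq> []" "\<forall>c\<in>set cs. 2 \<le> c"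
    and M: "M_prod cs = mat22 A B C D"
    and P: "P = [:- fls_of_poly B, fls_of_poly (D - A), fls_of_poly C:]" by auto
  have cyc: "\<forall>c\<in>sset (cycle cs). 2 \<le> c" using cs by (rule sset_cycle_ge_2)
  have Y: "Y = Phi_code (Infinite (cycle cs))"
    using * cyc by (simp only: Phi_point_of_Infinite)
  have "\<forall>c\<in>sset (bs @- cycle cs). 2 \<le> c" using bs cyc by (auto simp only: sset_shift)
  then have X: "Phi x = (Phi_code (Infinite (bs @- cycle cs)) :: 'p mod_ring fps)"
    using * by (simp only: Phi_point_of_Infinite)
  have Y0: "fps_nth Y 0 = 1" unfolding Y using cyc by (rule Phi_code_nth_0)
  have eq: "fps_of_poly C * Y\<^sup>2 + fps_of_poly (D - A) * Y - fps_of_poly B = 0"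
    using cs M Y by (rule Phi_code_cycle_equation)
  have coeff_0: "Polynomial.coeff A 0 = 1" "Polynomial.coeff C 0 = 1" "Polynomial.coeff D 0 = 0"
    using M_prod_row_1_coeff_0[OF M[symmetric] cs(2)] M_prod_row_2_coeff_0[OF M[symmetric] cs(2,1)]
    by (simp_all add: mat22_nth)

  let ?y = "fps_to_fls Y" and ?w = "fps_to_fls (Phi x :: 'p mod_ring fps)"
  let ?\<alpha> = "fls_of_poly C" and ?\<beta> = "fls_of_poly (D - A)" and ?\<gamma> = "- fls_of_poly B"
  have in_K: "?\<alpha> \<in> rat_funs" "?\<beta> \<in> rat_funs" "?\<gamma> \<in> rat_funs"
    by (intro fls_of_poly_in_rat_funs rat_funs.uminus_in)+
  have "C \<noteq> 0" using coeff_0 by auto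
  then have \<alpha>: "?\<alpha> \<noteq> 0" by (simp only: fls_of_poly_eq_0_iff not_False_eq_True)
  have root: "?\<alpha> * ?y\<^sup>2 + ?\<beta> * ?y + ?\<gamma> = 0"
    using arg_cong[OF eq, of fps_to_fls]
    by (simp only: fps_to_fls_plus fps_to_fls_minus fls_times_fps_to_fls fps_to_fls_power
        fps_zero_to_fls fps_to_fls_uminus diff_conv_add_uminus)
  have splits: "splits_over rat_funs P \<longleftrightarrow> ?y \<in> rat_funs"
    unfolding P by (rule rat_funs.quadratic_splits_iff_root_in[OF \<alpha> in_K(1,2) root])

  (* The preperiod acts by the linear fractional transformation over the rational functions
     with matrix m, which sends y to the image of x. *)
  define m where "m = (\<lambda>i j. fls_of_poly (M_prod bs $ i $ j) :: 'p mod_ring fls)"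
  have m_in: "m i j \<in> rat_funs" for i j unfolding m_def by (rule fls_of_poly_in_rat_funs)
  have "m 1 1 * m 2 2 - m 1 2 * m 2 1 =
      fls_of_poly (M_prod bs $ 1 $ 1 * M_prod bs $ 2 $ 2 - M_prod bs $ 1 $ 2 * M_prod bs $ 2 $ 1)"
    unfolding m_def fls_of_poly_diff fls_of_poly_mult ..
  then have det: "m 1 1 * m 2 2 - m 1 2 * m 2 1 \<noteq> 0"
    by (simp only: fls_of_poly_eq_0_iff M_prod_det_nonzero not_False_eq_True)
  have denom: "m 2 1 * ?y + m 2 2 = fps_to_fls (fps_of_poly (M_prod bs $ 2 $ 1) * Y +
      fps_of_poly (M_prod bs $ 2 $ 2))"
    unfolding m_def by (simp only: fps_to_fls_plus fls_times_fps_to_fls)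
  have "fps_nth (fps_of_poly (M_prod bs $ 2 $ 1) * Y + fps_of_poly (M_prod bs $ 2 $ 2)) 0 = 1"
    unfolding Y by (rule Phi_code_shift(2)[OF bs cyc])
  then have denom_nz: "m 2 1 * ?y + m 2 2 \<noteq> 0"
    unfolding denom fps_to_fls_eq_0_iff by (metis fps_zero_nth zero_neq_one)
  have moebius: "?w * (m 2 1 * ?y + m 2 2) = m 1 1 * ?y + m 1 2"
    unfolding m_def X Y
    using arg_cong[OF Phi_code_shift(1)[OF bs cyc], of fps_to_fls]
    by (simp only: fps_to_fls_plus fls_times_fps_to_fls)

  show "Z \<in> {1 + fps_X * f | f. True} \<and>
      fps_of_poly C * Z\<^sup>2 + fps_of_poly (D - A) * Z - fps_of_poly B = 0 \<longleftrightarrow> Z = Y" for Z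
    unfolding fps_constant_coeff_1_iff
    using cycle_equation_unique[OF cs M _ _ Y0 eq] Y0 eq by blast
  show "?w \<in> rat_funs \<longleftrightarrow> splits_over rat_funs P"
    unfolding splits by (rule rat_funs.moebius_in_iff[OF m_in m_in m_in m_in det denom_nz moebius])
  show "has_degree_over rat_funs ?w 2" if "\<not> splits_over rat_funs P"
    by (rule rat_funs.moebius_has_degree_2[OF m_in m_in m_in m_in det denom_nz moebius \<alpha> in_K root])
      (use that splits in simp)
  show "splits_over rat_funs P \<longleftrightarrow>
      (\<exists>u \<in> rat_funs. fls_of_poly ((D - A)\<^sup>2 + 4 * B * C) = u\<^sup>2)" if "odd p"
  proof -
    have two: "(2 :: 'p mod_ring fls) \<noteq> 0"
      using that assms by (auto simp: two_fls_eq_0_iff two_mod_ring_eq_0_iff)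
    have discriminant: "fls_of_poly ((D - A)\<^sup>2 + 4 * B * C) = ?\<beta>\<^sup>2 - 4 * ?\<alpha> * ?\<gamma>"
      unfolding fls_of_poly_add fls_of_poly_mult fls_of_poly_power by simp
    show ?thesis
      unfolding splits discriminant
      by (rule rat_funs.root_in_iff_discriminant_square[OF two \<alpha> in_K(1,2) root])
  qed
  show "splits_over rat_funs P \<longleftrightarrow>
      fls_of_poly (B * C) / fls_of_poly ((A + D)\<^sup>2) \<in> {u\<^sup>2 + u | u. u \<in> rat_funs}" if "p = 2"
  proof -
    have two: "(2 :: 'p mod_ring fls) = 0"
      using that assms by (simp add: two_fls_eq_0_iff two_mod_ring_eq_0_iff)
    have neg: "- z = z" for z :: "'p mod_ring fls"
      by (rule minus_unique) (simp only: mult_2[symmetric] two mult_zero_left)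
    have "Polynomial.coeff (D - A) 0 \<noteq> 0" using coeff_0 by simp
    then have "D - A \<noteq> 0" by auto
    then have \<beta>: "?\<beta> \<noteq> 0" by (simp only: fls_of_poly_eq_0_iff not_False_eq_True)
    have "fls_of_poly (A + D) = fls_of_poly D - - fls_of_poly A"
      by (simp add: fls_of_poly_add)
    also have "\<dots> = ?\<beta>" unfolding neg fls_of_poly_diff ..
    finally have quotient: "fls_of_poly (B * C) / fls_of_poly ((A + D)\<^sup>2) = ?\<alpha> * ?\<gamma> / ?\<beta>\<^sup>2"
      unfolding fls_of_poly_power fls_of_poly_mult neg by (simp only: mult.commute)
    show ?thesis
      unfolding splits quotient
      by (rule rat_funs.root_in_iff_artin_schreier[OF two \<alpha> \<beta> in_K(1,2) root])
  qed
qed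

end
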